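(* Let $V$ be a countable set, and for each ordered pair $(x,y)$ of distinct elements of $V$ let a probability distribution $\mu_{(x,y)}$ on $[0,\infty]$ be given. Let $\mathcal{I}$ be a countable index set. For each $i\in\mathcal{I}$ consider a first-passage percolation model on $V$ with deterministic source times $t_i(x)\in(-\infty,\infty]$, $x\in V$, and random passage times $W_i(e)$, where $W_i(e)$ has distribution $\mu_e$ for each directed edge $e$, the passage times of different edges are independent, and the models for different $i\in\mathcal{I}$ are independent of each other. Let $T_i(x)$ be the occupation time of $x$ in model $i$, and let $$\widetilde{T}(x):=\inf_{i\in\mathcal{I}}T_i(x),\qquad x\in V.$$ Consider another first-passage percolation model on $V$ with source times $t(x):=\inf_{i\in\mathcal{I}}t_i(x)$, $x\in V$ (assumed to lie in $(-\infty,\infty]$), and with independent passage times $W(e)$ having the same distributions $\mu_e$. Let $T(x)$ be the occupation time of $x$ in this model. Then $(\widetilde{T}(x))_{x\in V}$ is stochastically dominated by $(T(x))_{x\in V}$.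
   Context: In a first-passage percolation model on a countable vertex set $V$, every pair of distinct vertices $x,y\in V$ gives a directed edge $e=(x,y)$ assigned a random passage time $W(e)=W(x,y)$ taking values in $[0,\infty]$; the passage times of different edges are independent but not necessarily identically distributed. Each vertex $x$ has a deterministic source time $t(x)\in(-\infty,\infty]$. The occupation time of $x\in V$ is $$T(x):=\inf_{y_0,y_1,\dots,y_m:\; y_m=x}\Bigl\{t(y_0)+\sum_{k=1}^{m}W(y_{k-1},y_k)\Bigr\},$$ the infimum being over all finite sequences of vertices (with $m\ge 0$ and consecutive vertices distinct) ending at $x$. For random variables $X,Y$ taking values in the same partially ordered space, $Y$ is stochastically dominated by $X$ if there exist $X',Y'$ on some probability space with $X'$ equal in law to $X$, $Y'$ equal in law to $Y$, and $X'\geq Y'$ almost surely. For (extended-)real-valued functions on $V$ the partial order is pointwise ordering. *)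

theory Defs
  imports "HOL-Probability.Probability"
begin

definition edges :: "'v set \<Rightarrow> ('v \<times> 'v) set" where
  "edges V = {(x, y). x \<in> V \<and> y \<in> V \<and> x \<noteq> y}"

text \<open>
  The sequence \<open>y\<^sub>0, \<dots>, y\<^sub>m\<close> is represented by the nonempty list
  \<open>[y\<^sub>0, \<dots>, y\<^sub>m]\<close>, so \<open>m = length ys - 1\<close>.
\<close>

definition paths_to :: "'v set \<Rightarrow> 'v \<Rightarrow> 'v list set" where
  "paths_to V x = {ys. ys \<noteq> [] \<and> set ys \<subseteq> V \<and> distinct_adj ys \<and> last ys = x}"

text \<open>
  Here \<open>w\<close> is a realisation of the passage times. No clash of infinities occurs in the
  sum when the source times differ from \<open>-\<infinity>\<close>; the infimum itself may be \<open>-\<infinity>\<close>.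
\<close>

definition occupation_time ::
    "'v set \<Rightarrow> ('v \<Rightarrow> ereal) \<Rightarrow> ('v \<times> 'v \<Rightarrow> ennreal) \<Rightarrow> 'v \<Rightarrow> ereal" where
  "occupation_time V t w x =
     (INF ys \<in> paths_to V x.
        t (ys ! 0) + (\<Sum>k = 1..length ys - 1. enn2ereal (w (ys ! (k - 1), ys ! k))))"

locale fpp_model = prob_space M for M :: "'p measure" +
  fixes V :: "'v set"
    and \<mu> :: "'v \<times> 'v \<Rightarrow> ennreal measure"
    and t :: "'v \<Rightarrow> ereal"
    and W :: "'v \<times> 'v \<Rightarrow> 'p \<Rightarrow> ennreal"
  assumes countable_V: "countable V"
    and source_time: "x \<in> V \<Longrightarrow> t x \<noteq> -\<infinity>"
    and distr_W: "e \<in> edges V \<Longrightarrow> distr M borel (W e) = \<mu> e"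
    and indep_W: "indep_vars (\<lambda>_. borel) W (edges V)"

text \<open>
  \<open>stochastically_dominated N P Y Q X\<close>: the random variable \<open>Y\<close> on \<open>P\<close> is stochastically
  dominated by the random variable \<open>X\<close> on \<open>Q\<close>, both with values in \<open>N\<close>. As types cannot be
  quantified over, the coupling is taken on a probability space \<open>R\<close> with underlying type
  \<open>'a \<times> 'a\<close> but arbitrary \<open>\<sigma>\<close>-algebra. This loses no generality: a coupling
  \<open>(X', Y')\<close> on any probability space can be replaced by the two projections, with respect to
  the image measure under \<open>(X', Y')\<close> on the \<open>\<sigma>\<close>-algebra of all sets whose preimage is
  measurable in the completion.
\<close>

definition stochastically_dominated ::
    "('a :: order) measure \<Rightarrow> 'p measure \<Rightarrow> ('p \<Rightarrow> 'a) \<Rightarrow> 'q measure \<Rightarrow> ('q \<Rightarrow> 'a) \<Rightarrow> bool" where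
  "stochastically_dominated N P Y Q X \<longleftrightarrow>
     Y \<in> measurable P N \<and> X \<in> measurable Q N \<and>
     (\<exists>(R :: ('a \<times> 'a) measure) X' Y'.
        prob_space R \<and> X' \<in> measurable R N \<and> Y' \<in> measurable R N \<and>
        distr R N X' = distr Q N X \<and> distr R N Y' = distr P N Y \<and>
        (AE \<omega> in R. X' \<omega> \<ge> Y' \<omega>))"

text \<open>
  A random function on \<open>V\<close> is a random variable with values in \<open>Pi\<^sub>M V (\<lambda>_. borel)\<close>.
  The elements of that space agree outside \<open>V\<close>, so on it the order of the function type
  is the pointwise order on \<open>V\<close>.
\<close>

definition stochastically_dominated_on ::
    "'v set \<Rightarrow> 'p measure \<Rightarrow> ('p \<Rightarrow> 'v \<Rightarrow> ereal) \<Rightarrow> 'q measure \<Rightarrow> ('q \<Rightarrow> 'v \<Rightarrow> ereal) \<Rightarrow> bool" where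
  "stochastically_dominated_on V P Y Q X \<longleftrightarrow>
     stochastically_dominated (Pi\<^sub>M V (\<lambda>_. borel))
       P (\<lambda>\<omega>. restrict (Y \<omega>) V) Q (\<lambda>\<omega>. restrict (X \<omega>) V)"

end

theory Submission
  imports Defs
begin

text \<open>
  The merged model can be built from the individual models by exploring it in the order in
  which its vertices become occupied. Every occupied vertex inherits a model: the one whose
  source, or whose passage time from an earlier vertex, occupied it first. When a vertex \<open>x\<close>
  becomes occupied through model \<open>i\<close>, the passage times out of \<open>x\<close> have not yet been looked at,
  in any model, and those of model \<open>i\<close> may serve as the passage times out of \<open>x\<close> in the
  merged model. The choice of \<open>i\<close> depends only on passage times out of other vertices that
  were occupied before, so the passage times assembled in this way are again independent with
  the prescribed laws. A fastest path to \<open>x\<close> in the merged model now stays within one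
  model \<open>i\<close>, whence \<open>T(x) \<ge> T\<^sub>i(x)\<close>. For finitely many vertices and models this is
  \<open>finite_coupling\<close>, an induction which removes the vertex that is occupied first.

  In the infinite model there need be no first occupied vertex, and infima need not be
  attained. It is therefore approximated by finite sets of vertices, finite sets of models and
  passage times rounded upwards to finitely many values. The occupation times of the
  approximations decrease to those of the full models (\<open>occupation_time_tendsto\<close>), and
  rounding makes all laws discrete, so that the exploration raises no measurability questions.

  It remains to pass to the limit in the couplings, which do not fit together for different
  approximations. This is \<open>stochastically_dominated_decreasing_limit\<close>: stochastic domination of
  random functions on a countable set is preserved by decreasing pointwise limits. The events
  \<open>f x < q\<close> with rational \<open>q\<close> code a random function by a random bit sequence, bit sequences are
  coded by points of the Cantor set, and Helly's selection theorem on the real line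
  provides a limiting joint law.
\<close>

section \<open>Occupation times and paths\<close>

fun path_time :: "('v \<times> 'v \<Rightarrow> ennreal) \<Rightarrow> 'v list \<Rightarrow> ennreal" where
  "path_time w (x # y # ys) = w (x, y) + path_time w (y # ys)"
| "path_time w _ = 0"

lemma sum_consecutive_eq_path_time:
  "(\<Sum>k = 1..length ys - 1. enn2ereal (w (ys ! (k - 1), ys ! k))) = enn2ereal (path_time w ys)"
proof (induction w ys rule: path_time.induct)
  case (1 w x y ys)
  let ?f = "\<lambda>k. enn2ereal (w ((x # y # ys) ! (k - 1), (x # y # ys) ! k))"
  have "(\<Sum>k = 1..length (x # y # ys) - 1. ?f k) = ?f 1 + (\<Sum>k = Suc 1..Suc (length ys). ?f k)"
    by (subst sum.atLeast_Suc_atMost) simp_all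
  also have "(\<Sum>k = Suc 1..Suc (length ys). ?f k) = (\<Sum>k = 1..length ys. ?f (Suc k))"
    by (rule sum.shift_bounds_cl_Suc_ivl)
  also have "\<dots> = (\<Sum>k = 1..length (y # ys) - 1. enn2ereal (w ((y # ys) ! (k - 1), (y # ys) ! k)))"
    by (rule sum.cong) (auto simp: nth_Cons')
  finally show ?case
    by (simp only: 1) (simp add: plus_ennreal.rep_eq)
qed (auto simp: zero_ennreal.rep_eq)

lemma occupation_time_eq_INF_path_time:
  "occupation_time V t w x = (INF ys\<in>paths_to V x. t (hd ys) + enn2ereal (path_time w ys))"
  unfolding occupation_time_def sum_consecutive_eq_path_time
  by (intro INF_cong) (auto simp: paths_to_def hd_conv_nth)

lemma path_time_append:
  "path_time w (xs @ x # ys) = path_time w (xs @ [x]) + path_time w (x # ys)"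
proof (induction w xs rule: path_time.induct)
  case ("2_1" w)
  then show ?case by (cases ys) auto
next
  case ("2_2" w v)
  then show ?case by (cases ys) auto
qed (simp add: add.assoc)

lemma path_time_mono:
  assumes "distinct_adj ys" "set ys \<subseteq> V" "\<And>e. e \<in> edges V \<Longrightarrow> w e \<le> w' e"
  shows "path_time w ys \<le> path_time w' ys"
  using assms
  by (induction w ys rule: path_time.induct) (auto simp: edges_def intro!: add_mono)

lemma edges_mono: "A \<subseteq> B \<Longrightarrow> edges A \<subseteq> edges B"
  by (auto simp: edges_def)

lemma occupation_time_mono:
  assumes "V' \<subseteq> V" "\<And>x. x \<in> V' \<Longrightarrow> t x \<le> t' x" "\<And>e. e \<in> edges V' \<Longrightarrow> w e \<le> w' e"
  shows "occupation_time V t w x \<le> occupation_time V' t' w' x"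
  unfolding occupation_time_eq_INF_path_time
proof (rule INF_mono)
  fix ys assume ys: "ys \<in> paths_to V' x"
  then have "path_time w ys \<le> path_time w' ys"
    by (intro path_time_mono[of ys V']) (auto simp: paths_to_def assms)
  moreover have "t (hd ys) \<le> t' (hd ys)"
    using ys by (auto simp: paths_to_def assms(2) subset_iff)
  ultimately show "\<exists>zs\<in>paths_to V x. t (hd zs) + enn2ereal (path_time w zs)
      \<le> t' (hd ys) + enn2ereal (path_time w' ys)"
    using ys assms(1)
    by (intro bexI[of _ ys] add_mono) (auto simp: paths_to_def less_eq_ennreal.rep_eq)
qed

lemma occupation_time_cong:
  assumes "\<And>x. x \<in> V \<Longrightarrow> t x = t' x" "\<And>e. e \<in> edges V \<Longrightarrow> w e = w' e"
  shows "occupation_time V t w x = occupation_time V t' w' x"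
  by (intro antisym occupation_time_mono) (auto simp: assms)

lemma occupation_time_le_source:
  "x \<in> V \<Longrightarrow> occupation_time V t w x \<le> t x"
  unfolding occupation_time_eq_INF_path_time
  by (rule INF_lower2[of "[x]"]) (auto simp: paths_to_def zero_ennreal.rep_eq)

lemma earliest_le_occupation_time:
  assumes "\<And>z. z \<in> V \<Longrightarrow> c \<le> t z"
  shows "c \<le> occupation_time V t w x"
  unfolding occupation_time_eq_INF_path_time
proof (rule INF_greatest)
  fix ys assume "ys \<in> paths_to V x"
  then have "c \<le> t (hd ys)" by (intro assms) (auto simp: paths_to_def)
  then show "c \<le> t (hd ys) + enn2ereal (path_time w ys)"
    by (intro add_increasing2) auto
qed

text \<open>
  A vertex \<open>x\<close> can be removed once its outgoing edges have been turned into source times for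
  its neighbours: a path avoiding \<open>x\<close> in the reduced model stands for itself, or for itself
  preceded by \<open>x\<close>, depending on which of the two source times attains the minimum.
\<close>

lemma occupation_time_le_remove_vertex:
  assumes "x \<in> V"
  shows "occupation_time V t w y
    \<le> occupation_time (V - {x}) (\<lambda>z. min (t z) (t x + enn2ereal (w (x, z)))) w y"
  unfolding occupation_time_eq_INF_path_time
proof (rule INF_mono)
  fix ys assume ys: "ys \<in> paths_to (V - {x}) y"
  then obtain z zs where [simp]: "ys = z # zs" by (cases ys) (auto simp: paths_to_def)
  have "x # ys \<in> paths_to V y" "ys \<in> paths_to V y"
    using ys assms by (auto simp: paths_to_def)
  moreover have "t x + enn2ereal (path_time w (x # ys))
      = t x + enn2ereal (w (x, z)) + enn2ereal (path_time w ys)"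
    by (simp add: plus_ennreal.rep_eq add.assoc)
  ultimately show "\<exists>zs\<in>paths_to V y. t (hd zs) + enn2ereal (path_time w zs)
      \<le> min (t (hd ys)) (t x + enn2ereal (w (x, hd ys))) + enn2ereal (path_time w ys)"
    by (cases "t z \<le> t x + enn2ereal (w (x, z))")
      (auto simp: min_def intro: bexI[of _ ys] bexI[of _ "x # ys"])
qed

text \<open>
  Conversely, nothing is lost when \<open>x\<close> has the earliest source time. A path to \<open>y\<close> through
  \<open>x\<close> may be cut at its last visit to \<open>x\<close>, since starting there at time \<open>t x\<close> is at least as good as
  arriving there from elsewhere; what remains avoids \<open>x\<close>.
\<close>

lemma occupation_time_remove_earliest_le:
  assumes "x \<in> V" "\<And>z. z \<in> V \<Longrightarrow> t x \<le> t z" "y \<noteq> x"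
  shows "occupation_time (V - {x}) (\<lambda>z. min (t z) (t x + enn2ereal (w (x, z)))) w y
    \<le> occupation_time V t w y"
  unfolding occupation_time_eq_INF_path_time
proof (rule INF_mono)
  fix ys assume ys: "ys \<in> paths_to V y"
  let ?t = "\<lambda>z. min (t z) (t x + enn2ereal (w (x, z)))"
  show "\<exists>zs\<in>paths_to (V - {x}) y. ?t (hd zs) + enn2ereal (path_time w zs)
      \<le> t (hd ys) + enn2ereal (path_time w ys)"
  proof (cases "x \<in> set ys")
    case False
    then show ?thesis
      using ys by (intro bexI[of _ ys] add_mono) (auto simp: paths_to_def)
  next
    case True
    then obtain as bs where split: "ys = as @ x # bs" "x \<notin> set bs"
      by (meson split_list_last)
    with ys \<open>y \<noteq> x\<close> obtain z zs where bs: "bs = z # zs"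
      by (cases bs) (auto simp: paths_to_def)
    have bs_path: "bs \<in> paths_to (V - {x}) y"
      using ys split bs by (auto simp: paths_to_def distinct_adj_append_iff)
    have "?t z + enn2ereal (path_time w bs) \<le> t x + enn2ereal (w (x, z)) + enn2ereal (path_time w bs)"
      by (intro add_mono) auto
    also have "\<dots> = t x + enn2ereal (path_time w (x # bs))"
      by (simp add: bs plus_ennreal.rep_eq add.assoc)
    also have "\<dots> \<le> t (hd ys) + enn2ereal (path_time w ys)"
    proof (intro add_mono)
      show "t x \<le> t (hd ys)" using ys by (intro assms(2)) (auto simp: paths_to_def)
      have "path_time w (x # bs) \<le> path_time w ys"
        unfolding split(1) by (subst path_time_append) (rule add_increasing, simp_all)
      then show "enn2ereal (path_time w (x # bs)) \<le> enn2ereal (path_time w ys)"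
        by (simp only: less_eq_ennreal.rep_eq)
    qed
    finally show ?thesis using bs_path bs by (intro bexI[of _ bs]) auto
  qed
qed

lemma path_time_tendsto:
  assumes "distinct_adj ys" "set ys \<subseteq> V"
    "\<And>e. e \<in> edges V \<Longrightarrow> (\<lambda>n. w n e) \<longlonglongrightarrow> w' e"
  shows "(\<lambda>n. path_time (w n) ys) \<longlonglongrightarrow> path_time w' ys"
  using assms
  by (induction w' ys rule: path_time.induct) (auto simp: edges_def intro!: tendsto_add)

text \<open>
  Each path is finite, so it lies in some \<open>V n\<close>, and its cost converges; hence decreasing
  approximations of all data give decreasing approximations of the occupation times. The
  condition \<open>t' x \<noteq> -\<infinity>\<close> makes addition of the source time and the (possibly infinite)
  travel time continuous.
\<close>

lemma occupation_time_tendsto: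
  assumes V: "incseq V" "V' = (\<Union>n. V n)"
    and t_dec: "\<And>x. x \<in> V' \<Longrightarrow> decseq (\<lambda>n. t n x)"
    and t_lim: "\<And>x. x \<in> V' \<Longrightarrow> (\<lambda>n. t n x) \<longlonglongrightarrow> t' x" "\<And>x. x \<in> V' \<Longrightarrow> t' x \<noteq> -\<infinity>"
    and w_dec: "\<And>e. e \<in> edges V' \<Longrightarrow> decseq (\<lambda>n. w n e)"
    and w_lim: "\<And>e. e \<in> edges V' \<Longrightarrow> (\<lambda>n. w n e) \<longlonglongrightarrow> w' e"
  shows "decseq (\<lambda>n. occupation_time (V n) (t n) (w n) x)"
    and "(\<lambda>n. occupation_time (V n) (t n) (w n) x) \<longlonglongrightarrow> occupation_time V' t' w' x"
proof -
  have sub: "V n \<subseteq> V'" for n using V(2) by auto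
  show dec: "decseq (\<lambda>n. occupation_time (V n) (t n) (w n) x)"
    unfolding decseq_def
    by (intro allI impI occupation_time_mono)
      (use sub edges_mono[OF sub] incseqD[OF V(1)] decseqD[OF t_dec] decseqD[OF w_dec] in blast)+
  have "(INF n. occupation_time (V n) (t n) (w n) x) = occupation_time V' t' w' x"
  proof (intro antisym)
    show "occupation_time V' t' w' x \<le> (INF n. occupation_time (V n) (t n) (w n) x)"
    proof (intro INF_greatest occupation_time_mono)
      show "V n \<subseteq> V'" for n by (rule sub)
      show "t' x \<le> t n x" if "x \<in> V n" for n x
        using that sub by (intro decseq_ge t_dec t_lim) auto
      show "w' e \<le> w n e" if "e \<in> edges (V n)" for n e
        using that sub edges_mono[OF sub] by (intro decseq_ge w_dec w_lim) auto
    qed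
    show "(INF n. occupation_time (V n) (t n) (w n) x) \<le> occupation_time V' t' w' x"
      unfolding occupation_time_eq_INF_path_time[of V']
    proof (rule INF_greatest)
      fix ys assume ys: "ys \<in> paths_to V' x"
      then have hd: "hd ys \<in> V'" by (auto simp: paths_to_def)
      have "eventually (\<lambda>n. \<forall>z\<in>set ys. z \<in> V n) sequentially"
      proof (intro eventually_ball_finite ballI)
        fix z assume "z \<in> set ys"
        then obtain N where "z \<in> V N" using ys V(2) by (auto simp: paths_to_def)
        then show "eventually (\<lambda>n. z \<in> V n) sequentially"
          using incseqD[OF V(1)] by (auto simp: eventually_sequentially)
      qed simp
      then have "eventually (\<lambda>n. (INF n. occupation_time (V n) (t n) (w n) x)
          \<le> t n (hd ys) + enn2ereal (path_time (w n) ys)) sequentially"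
      proof eventually_elim
        case (elim n)
        then have "ys \<in> paths_to (V n) x"
          using ys by (auto simp: paths_to_def)
        then show ?case
          by (intro INF_lower2[of n])
            (auto simp: occupation_time_eq_INF_path_time intro: INF_lower)
      qed
      moreover have "(\<lambda>n. t n (hd ys) + enn2ereal (path_time (w n) ys))
          \<longlonglongrightarrow> t' (hd ys) + enn2ereal (path_time w' ys)"
      proof (rule tendsto_add_ereal_general)
        show "(\<lambda>n. enn2ereal (path_time (w n) ys)) \<longlonglongrightarrow> enn2ereal (path_time w' ys)"
          using ys by (intro tendsto_enn2erealI path_time_tendsto[of _ V'])
            (auto simp: paths_to_def w_lim)
      qed (use t_lim hd in auto)
      ultimately show "(INF n. occupation_time (V n) (t n) (w n) x)
          \<le> t' (hd ys) + enn2ereal (path_time w' ys)"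
        by (intro tendsto_lowerbound) auto
    qed
  qed
  with LIMSEQ_INF[OF dec]
  show "(\<lambda>n. occupation_time (V n) (t n) (w n) x) \<longlonglongrightarrow> occupation_time V' t' w' x" by simp
qed

section \<open>The exploration coupling of finite models\<close>

text \<open>
  The environments are organised by rows: for each vertex (and each model) one random element
  of a type \<open>'r\<close>, later the family of all passage times out of that vertex. The rule \<open>G' w\<close>
  chooses rows for the vertices other than \<open>x\<close> and may depend on the row \<open>w\<close> used at \<open>x\<close>.
  Since it produces the product law whatever \<open>w\<close> is, its output is independent of \<open>w\<close>. The
  rows of \<open>x\<close> in the models other than \<open>i\<close> are masked by the default value \<open>d\<close>, so that the
  rule cannot see them.
\<close>

lemma resample_vertex_law:
  fixes p :: "'v \<Rightarrow> 'r pmf" and G' :: "'r \<Rightarrow> ('i \<times> 'v \<Rightarrow> 'r) \<Rightarrow> 'v \<Rightarrow> 'r"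
  assumes fin: "finite U" "finite I" and x: "x \<in> U" and i: "i \<in> I"
    and G': "\<And>w. map_pmf (G' w) (Pi_pmf (I \<times> (U - {x})) d (p \<circ> snd)) = Pi_pmf (U - {x}) d p"
  shows "map_pmf (\<lambda>f. (G' (f (i, x)) (\<lambda>a. if a \<in> I \<times> (U - {x}) then f a else d))(x := f (i, x)))
      (Pi_pmf (I \<times> U) d (p \<circ> snd)) = Pi_pmf U d p"
    (is "map_pmf ?G _ = _")
proof -
  let ?B = "I \<times> (U - {x})" and ?A = "I \<times> U - {(i, x)}"
  let ?r = "\<lambda>f a. if a \<in> ?B then f a else d"
  have ins: "I \<times> U = insert (i, x) ?A" "U = insert x (U - {x})"
    using x i by auto
  have G_upd: "?G (f((i, x) := w)) = (G' w (?r f))(x := w)" for f w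
  proof -
    have "?r (f((i, x) := w)) = ?r f" by auto
    then show ?thesis by simp
  qed
  have "map_pmf ?G (Pi_pmf (I \<times> U) d (p \<circ> snd))
      = map_pmf ?G (Pi_pmf (insert (i, x) ?A) d (p \<circ> snd))"
    using ins by simp
  also have "\<dots> = p x \<bind> (\<lambda>w. Pi_pmf ?A d (p \<circ> snd) \<bind> (\<lambda>f. return_pmf ((G' w (?r f))(x := w))))"
    using fin by (subst Pi_pmf_insert') (simp_all add: map_bind_pmf G_upd del: fun_upd_apply)
  also have "\<dots> = p x \<bind> (\<lambda>w. map_pmf (\<lambda>g. g(x := w))
      (map_pmf (G' w) (map_pmf ?r (Pi_pmf ?A d (p \<circ> snd)))))"
    by (simp add: map_pmf_def bind_assoc_pmf bind_return_pmf)
  also have "\<And>w. map_pmf ?r (Pi_pmf ?A d (p \<circ> snd)) = Pi_pmf ?B d (p \<circ> snd)"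
    using fin by (intro Pi_pmf_subset[symmetric]) auto
  also have "p x \<bind> (\<lambda>w. map_pmf (\<lambda>g. g(x := w)) (map_pmf (G' w) (Pi_pmf ?B d (p \<circ> snd))))
      = p x \<bind> (\<lambda>w. Pi_pmf (U - {x}) d p \<bind> (\<lambda>g. return_pmf (g(x := w))))"
    unfolding G' by (simp add: map_pmf_def)
  also have "\<dots> = Pi_pmf (insert x (U - {x})) d p"
    using fin by (subst Pi_pmf_insert') auto
  finally show ?thesis by (simp only: insert_Diff[OF x])
qed

text \<open>
  The coupling is Dijkstra's exploration of the merged model. The vertex \<open>x\<close> with the earliest
  merged source time is occupied first, at that time, by a model \<open>i\<close> attaining the infimum.
  From then on only the row of \<open>x\<close> in model \<open>i\<close> is ever used, and it is taken as the row of \<open>x\<close> in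
  the merged model. Given this row, \<open>x\<close> is removed and the source times of model \<open>i\<close> are lowered
  accordingly; the remaining problem has one vertex less and involves only fresh rows. The
  merged occupation time is not changed by this step, while those of the individual models
  can only be increased by it.

  The coupling is a deterministic map \<open>G\<close> of the environments of the individual models, so that
  the inequality holds for every realisation.
\<close>

lemma finite_coupling:
  fixes p :: "'v \<Rightarrow> ('v \<Rightarrow> ennreal) pmf" and t :: "'i \<Rightarrow> 'v \<Rightarrow> ereal"
  assumes "finite U" and I: "finite I" "I \<noteq> {}"
  shows "\<exists>G. map_pmf G (Pi_pmf (I \<times> U) d (p \<circ> snd)) = Pi_pmf U d p \<and>
    (\<forall>f. \<forall>y\<in>U. (INF i\<in>I. occupation_time U (t i) (\<lambda>(a, b). f (i, a) b) y)
       \<le> occupation_time U (\<lambda>z. INF i\<in>I. t i z) (\<lambda>(a, b). G f a b) y)"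
  using \<open>finite U\<close>
proof (induction "card U" arbitrary: U t)
  case 0
  then show ?case by (intro exI[of _ "\<lambda>_ _. d"]) simp
next
  case (Suc n)
  let ?t = "\<lambda>z. INF i\<in>I. t i z"
  have "U \<noteq> {}" using Suc.hyps(2) by auto
  obtain x where x: "x \<in> U" "\<And>z. z \<in> U \<Longrightarrow> ?t x \<le> ?t z"
    using ex_min_if_finite[of "?t ` U"] Suc.prems \<open>U \<noteq> {}\<close> by (force simp: not_less)
  obtain i where i: "i \<in> I" "t i x = ?t x"
  proof -
    have "?t x = Min ((\<lambda>i. t i x) ` I)" using I by (simp add: Min_Inf)
    moreover have "Min ((\<lambda>i. t i x) ` I) \<in> (\<lambda>i. t i x) ` I" using I by (intro Min_in) auto
    ultimately show ?thesis using that by force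
  qed
  define t' where "t' w = t(i := \<lambda>z. min (t i z) (t i x + enn2ereal (w z)))" for w
  have "\<forall>w. \<exists>G. map_pmf G (Pi_pmf (I \<times> (U - {x})) d (p \<circ> snd)) = Pi_pmf (U - {x}) d p \<and>
      (\<forall>f. \<forall>y\<in>U - {x}. (INF j\<in>I. occupation_time (U - {x}) (t' w j) (\<lambda>(a, b). f (j, a) b) y)
        \<le> occupation_time (U - {x}) (\<lambda>z. INF j\<in>I. t' w j z) (\<lambda>(a, b). G f a b) y)"
    using Suc.hyps(2) Suc.prems x(1) by (intro allI Suc.hyps(1)) auto
  from choice[OF this] obtain G' where
    G'_law: "\<And>w. map_pmf (G' w) (Pi_pmf (I \<times> (U - {x})) d (p \<circ> snd)) = Pi_pmf (U - {x}) d p"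
    and G'_le: "\<And>w f y. y \<in> U - {x} \<Longrightarrow>
      (INF j\<in>I. occupation_time (U - {x}) (t' w j) (\<lambda>(a, b). f (j, a) b) y)
        \<le> occupation_time (U - {x}) (\<lambda>z. INF j\<in>I. t' w j z) (\<lambda>(a, b). G' w f a b) y"
    by blast
  let ?r = "\<lambda>f a. if a \<in> I \<times> (U - {x}) then f a else d"
  define G where "G f = (G' (f (i, x)) (?r f))(x := f (i, x))" for f
  have "(INF j\<in>I. occupation_time U (t j) (\<lambda>(a, b). f (j, a) b) y)
      \<le> occupation_time U ?t (\<lambda>(a, b). G f a b) y" if y: "y \<in> U" for f y
  proof (cases "y = x")
    case True
    have "(INF j\<in>I. occupation_time U (t j) (\<lambda>(a, b). f (j, a) b) y) \<le> t i x"
      using i(1) x(1) True by (auto intro!: INF_lower2[of i] occupation_time_le_source)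
    also have "t i x \<le> occupation_time U ?t (\<lambda>(a, b). G f a b) y"
      unfolding i(2) True
      by (rule earliest_le_occupation_time) (fact x(2))
    finally show ?thesis .
  next
    case False
    define w where "w = f (i, x)"
    have "(INF j\<in>I. occupation_time U (t j) (\<lambda>(a, b). f (j, a) b) y)
        \<le> (INF j\<in>I. occupation_time (U - {x}) (t' w j) (\<lambda>(a, b). ?r f (j, a) b) y)"
    proof (intro INF_mono bexI)
      fix j assume j: "j \<in> I"
      have "occupation_time U (t j) (\<lambda>(a, b). f (j, a) b) y
          \<le> occupation_time (U - {x}) (t' w j) (\<lambda>(a, b). f (j, a) b) y"
        using occupation_time_le_remove_vertex[OF x(1), of "t j" "\<lambda>(a, b). f (j, a) b" y]
        by (auto simp: t'_def w_def intro: occupation_time_mono)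
      also have "\<dots> = occupation_time (U - {x}) (t' w j) (\<lambda>(a, b). ?r f (j, a) b) y"
        using j by (intro occupation_time_cong) (auto simp: edges_def)
      finally show "occupation_time U (t j) (\<lambda>(a, b). f (j, a) b) y
          \<le> occupation_time (U - {x}) (t' w j) (\<lambda>(a, b). ?r f (j, a) b) y" .
    qed
    also have "\<dots> \<le> occupation_time (U - {x}) (\<lambda>z. INF j\<in>I. t' w j z)
        (\<lambda>(a, b). G' w (?r f) a b) y"
      using y False by (intro G'_le) auto
    also have "\<dots> \<le> occupation_time (U - {x})
        (\<lambda>z. min (?t z) (?t x + enn2ereal ((\<lambda>(a, b). G f a b) (x, z)))) (\<lambda>(a, b). G f a b) y"
    proof (intro occupation_time_mono min.boundedI INF_greatest)
      fix z
      show "(INF j\<in>I. t' w j z) \<le> t j z" if "j \<in> I" for j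
        using that by (intro INF_lower2[of j]) (auto simp: t'_def)
      show "(INF j\<in>I. t' w j z) \<le> ?t x + enn2ereal ((\<lambda>(a, b). G f a b) (x, z))"
        using i by (intro INF_lower2[of i]) (auto simp: t'_def G_def w_def)
    qed (auto simp: edges_def G_def w_def)
    also have "\<dots> \<le> occupation_time U ?t (\<lambda>(a, b). G f a b) y"
      using x False by (rule occupation_time_remove_earliest_le)
    finally show ?thesis .
  qed
  moreover have "map_pmf G (Pi_pmf (I \<times> U) d (p \<circ> snd)) = Pi_pmf U d p"
    unfolding G_def using resample_vertex_law[OF Suc.prems I(1) x(1) i(1) G'_law] .
  ultimately show ?case by auto
qed

section \<open>Compactness for laws of random bit sequences\<close>

text \<open>
  A bit sequence is coded by a point of the Cantor set, so that tightness on the real line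
  becomes available for laws of random bit sequences.
\<close>

definition ternary :: "(nat \<Rightarrow> bool) \<Rightarrow> real" where
  "ternary b = (\<Sum>n. 2 * of_bool (b n) / 3 ^ Suc n)"

definition clamp_middle_third :: "real \<Rightarrow> real" where
  "clamp_middle_third z = max 0 (min 1 (3 * z - 1))"

text \<open>
  The digits of a point of the Cantor set are read off by functions that are continuous on the
  whole line: the clamp is 0 to the left and 1 to the right of the middle third, and linear
  inside it.
\<close>

fun ternary_digit :: "nat \<Rightarrow> real \<Rightarrow> real" where
  "ternary_digit 0 z = clamp_middle_third z"
| "ternary_digit (Suc n) z = ternary_digit n (3 * z - 2 * clamp_middle_third z)"

lemma ternary_sums_one: "(\<lambda>n. 2 / 3 ^ Suc n :: real) sums 1"
  using sums_mult[OF geometric_sums[of "1 / 3 :: real"], of "2 / 3"]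
  by (simp add: power_divide)

lemma summable_ternary: "summable (\<lambda>n. 2 * of_bool (b n) / 3 ^ Suc n :: real)"
  by (rule summable_comparison_test'[OF sums_summable[OF ternary_sums_one], of 0]) auto

lemma ternary_nonneg: "0 \<le> ternary b"
  unfolding ternary_def by (intro suminf_nonneg summable_ternary) auto

lemma ternary_le_1: "ternary b \<le> 1"
  unfolding ternary_def sums_unique[OF ternary_sums_one]
  by (intro suminf_le summable_ternary sums_summable[OF ternary_sums_one]) auto

lemma ternary_Suc: "ternary b = (2 * of_bool (b 0) + ternary (b \<circ> Suc)) / 3"
proof -
  have "ternary b = (\<Sum>n. 2 * of_bool (b (Suc n)) / 3 ^ Suc (Suc n)) + 2 * of_bool (b 0) / 3"
    unfolding ternary_def by (subst suminf_split_head[OF summable_ternary]) simp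
  also have "(\<Sum>n. 2 * of_bool (b (Suc n)) / 3 ^ Suc (Suc n)) = ternary (b \<circ> Suc) / 3"
    unfolding ternary_def
    by (subst suminf_divide[symmetric, OF summable_ternary]) (simp add: mult_ac)
  finally show ?thesis by simp
qed

lemma ternary_digit_ternary: "ternary_digit n (ternary b) = of_bool (b n)"
proof (induction n arbitrary: b)
  case 0
  then show ?case
    using ternary_nonneg[of "b \<circ> Suc"] ternary_le_1[of "b \<circ> Suc"]
    by (subst ternary_Suc) (auto simp: clamp_middle_third_def)
next
  case (Suc n)
  have "clamp_middle_third (ternary b) = of_bool (b 0)"
    using ternary_nonneg[of "b \<circ> Suc"] ternary_le_1[of "b \<circ> Suc"]
    by (subst ternary_Suc) (auto simp: clamp_middle_third_def)
  moreover have "3 * ternary b = 2 * of_bool (b 0) + ternary (b \<circ> Suc)"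
    by (subst ternary_Suc) simp
  ultimately have "3 * ternary b - 2 * clamp_middle_third (ternary b) = ternary (b \<circ> Suc)"
    by linarith
  then show ?case by (simp add: Suc.IH)
qed

lemma isCont_clamp: "isCont clamp_middle_third z"
  unfolding clamp_middle_third_def by (intro continuous_intros)

lemma isCont_ternary_digit: "isCont (ternary_digit n) z"
proof (induction n arbitrary: z)
  case 0
  then show ?case using isCont_clamp by simp
next
  case (Suc n)
  have "isCont (\<lambda>z. ternary_digit n (3 * z - 2 * clamp_middle_third z)) z"
    by (rule isCont_o2[of z "\<lambda>z. 3 * z - 2 * clamp_middle_third z"])
      (intro continuous_intros isCont_clamp Suc)+
  then show ?case by simp
qed

lemma ternary_digit_bounds: "0 \<le> ternary_digit n z" "ternary_digit n z \<le> 1"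
  by (induction n arbitrary: z) (auto simp: clamp_middle_third_def)

text \<open>
  Compactness of the space of laws on the Cantor space, stated for random variables. The coded
  sequences have values in \<open>[0, 1]\<close>, so a subsequence of their laws converges weakly.
  Finite-dimensional probabilities of bits are expectations of products of the continuous digit
  functions; hence they converge along the subsequence.
\<close>

lemma random_bits_convergent_subsequence:
  fixes R :: "nat \<Rightarrow> 'r measure" and B :: "nat \<Rightarrow> 'r \<Rightarrow> 'k :: countable \<Rightarrow> bool"
  assumes R: "\<And>n. prob_space (R n)"
    and B[measurable]: "\<And>n k. Measurable.pred (R n) (\<lambda>\<omega>. B n \<omega> k)"
  obtains s :: "nat \<Rightarrow> nat" and M :: "real measure" and b :: "real \<Rightarrow> 'k \<Rightarrow> bool"
  where "strict_mono s" "prob_space M" "\<And>k. Measurable.pred M (\<lambda>z. b z k)"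
    "\<And>F A. finite F \<Longrightarrow>
       (\<lambda>n. measure (R (s n)) {\<omega>\<in>space (R (s n)). \<forall>k\<in>F. B (s n) \<omega> k \<in> A k})
         \<longlonglongrightarrow> measure M {z\<in>space M. \<forall>k\<in>F. b z k \<in> A k}"
proof -
  define Z where "Z n \<omega> = ternary (\<lambda>j. B n \<omega> (from_nat j))" for n \<omega>
  have [measurable]: "Z n \<in> borel_measurable (R n)" for n
    unfolding Z_def ternary_def by measurable
  define \<mu> where "\<mu> n = distr (R n) borel (Z n)" for n
  have dist: "real_distribution (\<mu> n)" for n
    unfolding \<mu>_def by (intro prob_space.real_distribution_distr R) simp
  have "tight \<mu>"
    unfolding tight_def
  proof (intro conjI allI impI)
    fix \<epsilon> :: real assume "\<epsilon> > 0"
    have "1 - \<epsilon> < measure (\<mu> n) {-1<..1}" for n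
    proof -
      interpret prob_space "R n" by (rule R)
      have "measure (\<mu> n) {-1<..1} = prob (Z n -` {-1<..1} \<inter> space (R n))"
        unfolding \<mu>_def by (rule measure_distr) auto
      also have "Z n -` {-1<..1} \<inter> space (R n) = space (R n)"
        using less_le_trans[OF _ ternary_nonneg, of "-1"] ternary_le_1 by (auto simp: Z_def)
      finally show ?thesis using \<open>\<epsilon> > 0\<close> by (simp add: prob_space)
    qed
    then have "(-1 :: real) < 1 \<and> (\<forall>n. 1 - \<epsilon> < measure (\<mu> n) {-1<..1})" by simp
    then show "\<exists>a b. a < b \<and> (\<forall>n. 1 - \<epsilon> < measure (\<mu> n) {a<..b})" by blast
  qed (use dist in auto)
  from tight_imp_convergent_subsubsequence[OF this, of id]
  obtain s M where s: "strict_mono s" and M: "real_distribution M" and conv: "weak_conv_m (\<mu> \<circ> s) M"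
    by (auto simp: strict_mono_id)
  interpret M: real_distribution M by (rule M)
  note [measurable_cong] = M.events_eq_borel
  have lim: "(\<lambda>n. integral\<^sup>L (R (s n)) (\<lambda>\<omega>. f (Z (s n) \<omega>))) \<longlonglongrightarrow> integral\<^sup>L M f"
    if f: "\<And>z. isCont f z" "\<And>z. \<bar>f z\<bar> \<le> 1" for f :: "real \<Rightarrow> real"
  proof -
    have [measurable]: "f \<in> borel_measurable borel"
      using f(1) by (intro borel_measurable_continuous_onI continuous_at_imp_continuous_on) auto
    have "(\<lambda>n. integral\<^sup>L ((\<mu> \<circ> s) n) f) \<longlonglongrightarrow> integral\<^sup>L M f"
      by (rule weak_conv_imp_integral_bdd_continuous_conv[OF _ M conv, of f 1])
        (use dist f in auto)
    also have "(\<lambda>n. integral\<^sup>L ((\<mu> \<circ> s) n) f) = (\<lambda>n. integral\<^sup>L (R (s n)) (\<lambda>\<omega>. f (Z (s n) \<omega>)))"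
      by (simp add: \<mu>_def integral_distr)
    finally show ?thesis .
  qed
  define g where "g z k = ternary_digit (to_nat k) z" for z and k :: 'k
  have g_Z: "g (Z n \<omega>) k = of_bool (B n \<omega> k)" for n \<omega> k
    by (simp add: g_def Z_def ternary_digit_ternary)
  have g_cont: "isCont (\<lambda>z. g z k) z" for k z
    unfolding g_def by (rule isCont_ternary_digit)
  have g_bounds: "0 \<le> g z k" "g z k \<le> 1" for z k
    by (auto simp: g_def ternary_digit_bounds)
  have [measurable]: "(\<lambda>z. g z k) \<in> borel_measurable borel" for k
    using g_cont by (intro borel_measurable_continuous_onI continuous_at_imp_continuous_on) auto
  (* Under the limit law the digit functions still take only the values 0 and 1, because
     the expectation of the bounded continuous function \<open>g (1 - g)\<close> vanishes along the sequence. *)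
  have g_01: "AE z in M. g z k = 0 \<or> g z k = 1" for k
  proof -
    have bd: "\<bar>g z k * (1 - g z k)\<bar> \<le> 1" for z
      using g_bounds[of z k] by (simp add: abs_mult mult_le_one)
    have "(\<lambda>n. integral\<^sup>L (R (s n)) (\<lambda>\<omega>. g (Z (s n) \<omega>) k * (1 - g (Z (s n) \<omega>) k)))
        \<longlonglongrightarrow> integral\<^sup>L M (\<lambda>z. g z k * (1 - g z k))"
      by (rule lim[of "\<lambda>z. g z k * (1 - g z k)"]) (intro continuous_intros g_cont bd)+
    then have "integral\<^sup>L M (\<lambda>z. g z k * (1 - g z k)) = 0"
      unfolding g_Z by (simp add: of_bool_def if_distrib LIMSEQ_const_iff cong: if_cong)
    moreover have "integrable M (\<lambda>z. g z k * (1 - g z k))"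
      by (rule M.integrable_const_bound[of _ 1]) (use bd in auto)
    ultimately have "AE z in M. g z k * (1 - g z k) = 0"
      using g_bounds by (subst (asm) integral_nonneg_eq_0_iff_AE) auto
    then show ?thesis by eventually_elim auto
  qed
  define b where "b z k \<longleftrightarrow> g z k = 1" for z k
  (* \<open>\<phi> A\<close> is the affine function that agrees with the indicator of \<open>A\<close> on the values of a bit. *)
  define \<phi> where "\<phi> A x = (if True \<in> A then x else 0) + (if False \<in> A then 1 - x else 0)"
    for A and x :: real
  have \<phi>_of_bool: "\<phi> A (of_bool c) = of_bool (c \<in> A)" for A c
    by (cases c) (auto simp: \<phi>_def)
  have \<phi>_bounds: "0 \<le> \<phi> A x" "\<phi> A x \<le> 1" if "0 \<le> x" "x \<le> 1" for A x
    using that by (auto simp: \<phi>_def)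
  have \<phi>_cont: "isCont (\<lambda>z. \<phi> A (g z k)) z" for A k z
    by (cases "True \<in> A"; cases "False \<in> A")
      (auto simp: \<phi>_def intro!: continuous_intros g_cont)
  have prod_of_bool: "(\<Prod>k\<in>F. of_bool (P k)) = (of_bool (\<forall>k\<in>F. P k) :: real)"
    if "finite F" for F :: "'k set" and P
    using that by induction auto
  show thesis
  proof (rule that[OF s])
    show "prob_space M" by (rule M.prob_space_axioms)
    show b_meas[measurable]: "Measurable.pred M (\<lambda>z. b z k)" for k
      unfolding b_def by measurable
    fix F :: "'k set" and A :: "'k \<Rightarrow> bool set" assume F[simp]: "finite F"
    have [measurable]: "countable F" using F by (rule countable_finite)
    define f where "f z = (\<Prod>k\<in>F. \<phi> (A k) (g z k))" for z
    have "(\<lambda>n. integral\<^sup>L (R (s n)) (\<lambda>\<omega>. f (Z (s n) \<omega>))) \<longlonglongrightarrow> integral\<^sup>L M f"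
    proof (rule lim)
      show "isCont f z" for z
        unfolding f_def by (intro continuous_intros \<phi>_cont)
      show "\<bar>f z\<bar> \<le> 1" for z
        unfolding f_def abs_prod by (intro prod_le_1) (auto simp: \<phi>_bounds g_bounds)
    qed
    moreover have "integral\<^sup>L (R n) (\<lambda>\<omega>. f (Z n \<omega>))
        = measure (R n) {\<omega>\<in>space (R n). \<forall>k\<in>F. B n \<omega> k \<in> A k}" for n
    proof -
      have "integral\<^sup>L (R n) (\<lambda>\<omega>. f (Z n \<omega>))
          = integral\<^sup>L (R n) (indicator {\<omega>\<in>space (R n). \<forall>k\<in>F. B n \<omega> k \<in> A k})"
        by (intro Bochner_Integration.integral_cong)
          (auto simp: f_def g_Z \<phi>_of_bool prod_of_bool indicator_def)
      then show ?thesis by simp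
    qed
    moreover have "integral\<^sup>L M f = measure M {z\<in>space M. \<forall>k\<in>F. b z k \<in> A k}"
    proof -
      have [measurable]: "f \<in> borel_measurable borel"
        unfolding f_def \<phi>_def by measurable
      have "AE z in M. g z k = of_bool (b z k)" for k
        using g_01[of k] by eventually_elim (auto simp: b_def)
      with F have "AE z in M. \<forall>k\<in>F. g z k = of_bool (b z k)"
        by (rule AE_finite_allI)
      then have "AE z in M. f z = indicator {z\<in>space M. \<forall>k\<in>F. b z k \<in> A k} z"
        by eventually_elim (auto simp: f_def \<phi>_of_bool prod_of_bool indicator_def cong: prod.cong)
      then have "integral\<^sup>L M f = integral\<^sup>L M (indicator {z\<in>space M. \<forall>k\<in>F. b z k \<in> A k})"
        by (intro integral_cong_AE) auto
      then show ?thesis by simp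
    qed
    ultimately show "(\<lambda>n. measure (R (s n)) {\<omega>\<in>space (R (s n)). \<forall>k\<in>F. B (s n) \<omega> k \<in> A k})
        \<longlonglongrightarrow> measure M {z\<in>space M. \<forall>k\<in>F. b z k \<in> A k}" by simp
  qed
qed

section \<open>Stochastic domination under decreasing limits\<close>

text \<open>
  A coupling on a probability space of any type may be transported to the product type that
  the definition of stochastic domination asks for, by passing to the joint law.
\<close>

lemma stochastically_dominatedI:
  fixes V :: "'v set" and X :: "'q \<Rightarrow> 'v \<Rightarrow> ereal"
  defines "N \<equiv> Pi\<^sub>M V (\<lambda>_. borel)"
  assumes V: "countable V" and R: "prob_space R"
    and XY: "X \<in> measurable Q N" "Y \<in> measurable P N"
    and X'[measurable]: "X' \<in> measurable R N" and Y'[measurable]: "Y' \<in> measurable R N"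
    and law: "distr R N X' = distr Q N X" "distr R N Y' = distr P N Y"
    and le: "AE \<omega> in R. \<forall>x\<in>V. Y' \<omega> x \<le> X' \<omega> x"
  shows "stochastically_dominated N P Y Q X"
proof -
  let ?S = "N \<Otimes>\<^sub>M N" and ?XY = "\<lambda>\<omega>. (X' \<omega>, Y' \<omega>)"
  let ?D = "distr R ?S ?XY"
  have comp: "(\<lambda>f. f x) \<in> borel_measurable N" if "x \<in> V" for x
    unfolding N_def using that by (rule measurable_component_singleton)
  have "AE p in ?D. snd p x \<le> fst p x" if x: "x \<in> V" for x
  proof -
    note [measurable] = comp[OF x]
    have "AE \<omega> in R. Y' \<omega> x \<le> X' \<omega> x" using le by eventually_elim (use x in auto)
    then show ?thesis by (subst AE_distr_iff) auto
  qed
  then have "AE p in ?D. \<forall>x\<in>V. snd p x \<le> fst p x"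
    using V by (simp add: AE_ball_countable)
  moreover have "AE p in ?D. p \<in> space ?S"
    using AE_space[of ?D] by simp
  ultimately have "AE p in ?D. fst p \<ge> snd p"
  proof eventually_elim
    case (elim p)
    have "fst p x = undefined" "snd p x = undefined" if "x \<notin> V" for x
      using elim(2) that by (auto simp: N_def space_pair_measure space_PiM PiE_def extensional_def)
    then have "snd p x \<le> fst p x" for x using elim(1) by (cases "x \<in> V") auto
    then show ?case by (auto simp: le_fun_def)
  qed
  moreover have "prob_space ?D" by (intro prob_space.prob_space_distr R) measurable
  moreover have "distr ?D N fst = distr Q N X" "distr ?D N snd = distr P N Y"
    by (simp_all add: distr_distr comp_def law)
  ultimately show ?thesis
    unfolding stochastically_dominated_def using XY
    by (intro conjI exI[of _ ?D] exI[of _ fst] exI[of _ snd]) simp_all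
qed

text \<open>
  A function on \<open>V\<close> is coded by the bits telling whether \<open>f x < q\<close>, for \<open>x \<in> V\<close> and rational
  \<open>q\<close>. The inequality is strict because then each bit is eventually constant along decreasing
  pointwise limits. The guard \<open>from_nat_into V j \<in> V\<close> matters only for empty \<open>V\<close>.
\<close>

definition level_bits :: "'v set \<Rightarrow> ('v \<Rightarrow> ereal) \<Rightarrow> nat \<times> rat \<Rightarrow> bool" where
  "level_bits V f = (\<lambda>(j, q). from_nat_into V j \<in> V \<and> f (from_nat_into V j) < ereal (of_rat q))"

definition decode_levels :: "'v set \<Rightarrow> (nat \<times> rat \<Rightarrow> bool) \<Rightarrow> 'v \<Rightarrow> ereal" where
  "decode_levels V c = (\<lambda>x\<in>V. INF q. if c (to_nat_on V x, q) then ereal (of_rat q) else \<infinity>)"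

lemma decode_level_bits:
  assumes V: "countable V" and f: "f \<in> space (Pi\<^sub>M V (\<lambda>_. borel))"
  shows "decode_levels V (level_bits V f) = f"
proof
  fix x
  show "decode_levels V (level_bits V f) x = f x"
  proof (cases "x \<in> V")
    case False
    then show ?thesis
      using f by (auto simp: decode_levels_def space_PiM PiE_def extensional_def)
  next
    case True
    have "(INF q. if f x < ereal (of_rat q) then ereal (of_rat q) else \<infinity>) = f x"
    proof (intro antisym)
      show "f x \<le> (INF q. if f x < ereal (of_rat q) then ereal (of_rat q) else \<infinity>)"
        by (intro INF_greatest) auto
      show "(INF q. if f x < ereal (of_rat q) then ereal (of_rat q) else \<infinity>) \<le> f x"
      proof (rule dense_ge)
        fix y assume "f x < y"
        then obtain q :: rat where q: "f x < ereal (of_rat q)" "ereal (of_rat q) < y"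
          using ereal_dense3 by blast
        show "(INF q. if f x < ereal (of_rat q) then ereal (of_rat q) else \<infinity>) \<le> y"
          using q by (intro INF_lower2[of q]) auto
      qed
    qed
    then show ?thesis using V True by (simp add: decode_levels_def level_bits_def)
  qed
qed

lemma decode_levels_mono:
  assumes "\<And>k. c k \<Longrightarrow> c' k" "x \<in> V"
  shows "decode_levels V c' x \<le> decode_levels V c x"
proof -
  have "(INF q. if c' (to_nat_on V x, q) then ereal (of_rat q) else \<infinity>)
      \<le> (INF q. if c (to_nat_on V x, q) then ereal (of_rat q) else \<infinity>)"
    by (rule INF_mono') (use assms(1) in auto)
  then show ?thesis using assms(2) by (simp only: decode_levels_def restrict_apply' if_True)
qed

lemma measurable_decode_levels[measurable]:
  "decode_levels V \<in> measurable (Pi\<^sub>M UNIV (\<lambda>_. count_space UNIV)) (Pi\<^sub>M V (\<lambda>_. borel))"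
  unfolding decode_levels_def by (intro measurable_restrict) measurable

lemma pred_level_bits:
  assumes "X \<in> measurable M (Pi\<^sub>M V (\<lambda>_. borel))"
  shows "Measurable.pred M (\<lambda>\<omega>. level_bits V (X \<omega>) k)"
proof (cases "from_nat_into V (fst k) \<in> V")
  case True
  have [measurable]: "(\<lambda>\<omega>. X \<omega> (from_nat_into V (fst k))) \<in> borel_measurable M"
    using measurable_compose[OF assms measurable_component_singleton[OF True]] .
  show ?thesis by (simp add: level_bits_def case_prod_beta True)
qed (simp add: level_bits_def case_prod_beta)

lemma distr_decode_levels_eq:
  assumes V: "countable V" and "prob_space M" "prob_space Q"
    and X: "X \<in> measurable Q (Pi\<^sub>M V (\<lambda>_. borel))"
    and b[measurable]: "\<And>k. Measurable.pred M (\<lambda>z. b z k)"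
    and eq: "\<And>F A. finite F \<Longrightarrow> measure M {z\<in>space M. \<forall>k\<in>F. b z k \<in> A k}
      = measure Q {\<omega>\<in>space Q. \<forall>k\<in>F. level_bits V (X \<omega>) k \<in> A k}"
  shows "distr M (Pi\<^sub>M V (\<lambda>_. borel)) (\<lambda>z. decode_levels V (b z)) = distr Q (Pi\<^sub>M V (\<lambda>_. borel)) X"
proof -
  interpret M: prob_space M by fact
  interpret Q: prob_space Q by fact
  let ?C = "Pi\<^sub>M UNIV (\<lambda>_. count_space UNIV) :: (nat \<times> rat \<Rightarrow> bool) measure"
  note [measurable] = pred_level_bits[OF X]
  have b_meas[measurable]: "b \<in> measurable M ?C"
    by (rule measurable_PiM_single') (auto simp: pred_def)
  have X_meas[measurable]: "(\<lambda>\<omega>. level_bits V (X \<omega>)) \<in> measurable Q ?C"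
    by (rule measurable_PiM_single') auto
  have "distr M ?C b = distr Q ?C (\<lambda>\<omega>. level_bits V (X \<omega>))"
  proof (rule measure_eqI_PiM_infinite)
    show "finite_measure (distr M ?C b)"
      by (intro prob_space.finite_measure M.prob_space_distr) measurable
    fix F :: "(nat \<times> rat) set" and A :: "nat \<times> rat \<Rightarrow> bool set" assume F: "finite F"
    let ?E = "prod_emb UNIV (\<lambda>_. count_space UNIV) F (Pi\<^sub>E F A)"
    have E: "?E = {c. \<forall>k\<in>F. c k \<in> A k}"
      by (auto simp: prod_emb_def space_PiM PiE_def Pi_def extensional_def)
    have E_sets: "?E \<in> sets ?C"
      by (rule sets_PiM_I) (use F in auto)
    have "emeasure (distr M ?C b) ?E = measure M {z\<in>space M. \<forall>k\<in>F. b z k \<in> A k}"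
      by (subst emeasure_distr[OF b_meas E_sets])
        (auto simp: E M.emeasure_eq_measure intro!: arg_cong[where f="measure M"])
    also have "\<dots> = emeasure (distr Q ?C (\<lambda>\<omega>. level_bits V (X \<omega>))) ?E"
      unfolding eq[OF F]
      by (subst emeasure_distr[OF X_meas E_sets])
        (auto simp: E Q.emeasure_eq_measure intro!: arg_cong[where f="measure Q"])
    finally show "emeasure (distr M ?C b) ?E
        = emeasure (distr Q ?C (\<lambda>\<omega>. level_bits V (X \<omega>))) ?E" .
  qed simp_all
  then have "distr (distr M ?C b) (Pi\<^sub>M V (\<lambda>_. borel)) (decode_levels V)
      = distr (distr Q ?C (\<lambda>\<omega>. level_bits V (X \<omega>))) (Pi\<^sub>M V (\<lambda>_. borel)) (decode_levels V)"
    by simp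
  also have "distr (distr Q ?C (\<lambda>\<omega>. level_bits V (X \<omega>))) (Pi\<^sub>M V (\<lambda>_. borel)) (decode_levels V)
      = distr Q (Pi\<^sub>M V (\<lambda>_. borel)) X"
    using measurable_space[OF X]
    by (subst distr_distr) (auto intro!: distr_cong decode_level_bits V)
  finally show ?thesis by (simp add: distr_distr comp_def)
qed

text \<open>
  If \<open>X < q\<close> at some vertex then also \<open>Xn n < q\<close> for large \<open>n\<close>, and if \<open>X \<ge> q\<close> then
  \<open>Xn n \<ge> q\<close> for all \<open>n\<close>; so the events converge pointwise.
\<close>

lemma level_bits_prob_tendsto:
  assumes "prob_space Q"
    and X: "X \<in> measurable Q (Pi\<^sub>M V (\<lambda>_. borel))"
    and Xn: "\<And>n. Xn n \<in> measurable Q (Pi\<^sub>M V (\<lambda>_. borel))"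
    and dec: "\<And>\<omega> x. \<omega> \<in> space Q \<Longrightarrow> x \<in> V \<Longrightarrow> decseq (\<lambda>n. Xn n \<omega> x)"
    and lim: "\<And>\<omega> x. \<omega> \<in> space Q \<Longrightarrow> x \<in> V \<Longrightarrow> (\<lambda>n. Xn n \<omega> x) \<longlonglongrightarrow> X \<omega> x"
    and F: "finite F"
  shows "(\<lambda>n. measure Q {\<omega>\<in>space Q. \<forall>k\<in>F. level_bits V (Xn n \<omega>) k \<in> A k})
    \<longlonglongrightarrow> measure Q {\<omega>\<in>space Q. \<forall>k\<in>F. level_bits V (X \<omega>) k \<in> A k}"
proof -
  interpret prob_space Q by fact
  note [measurable] = pred_level_bits[OF X] pred_level_bits[OF Xn]
  have [measurable]: "countable F" using F by (rule countable_finite)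
  let ?E = "\<lambda>n. {\<omega>\<in>space Q. \<forall>k\<in>F. level_bits V (Xn n \<omega>) k \<in> A k}"
  let ?E' = "{\<omega>\<in>space Q. \<forall>k\<in>F. level_bits V (X \<omega>) k \<in> A k}"
  have ev: "eventually (\<lambda>n. level_bits V (Xn n \<omega>) k = level_bits V (X \<omega>) k) sequentially"
    if \<omega>: "\<omega> \<in> space Q" for \<omega> k
  proof (cases "from_nat_into V (fst k) \<in> V \<and> X \<omega> (from_nat_into V (fst k)) < ereal (of_rat (snd k))")
    case True
    then have "eventually (\<lambda>n. Xn n \<omega> (from_nat_into V (fst k)) < ereal (of_rat (snd k))) sequentially"
      using order_tendstoD(2)[OF lim[OF \<omega>]] by auto
    then show ?thesis by eventually_elim (use True in \<open>auto simp: level_bits_def case_prod_beta\<close>)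
  next
    case False
    then have "level_bits V (Xn n \<omega>) k = level_bits V (X \<omega>) k" for n
      using decseq_ge[OF dec lim, OF \<omega> _ \<omega>, of "from_nat_into V (fst k)" n]
      by (auto simp: level_bits_def case_prod_beta)
    then show ?thesis by simp
  qed
  have "(\<lambda>n. integral\<^sup>L Q (indicator (?E n) :: _ \<Rightarrow> real)) \<longlonglongrightarrow> integral\<^sup>L Q (indicator ?E')"
  proof (rule integral_dominated_convergence[where w = "\<lambda>_. 1"])
    show "AE \<omega> in Q. (\<lambda>n. indicator (?E n) \<omega> :: real) \<longlonglongrightarrow> indicator ?E' \<omega>"
    proof (intro AE_I2 tendsto_eventually)
      fix \<omega> assume \<omega>: "\<omega> \<in> space Q"
      have "eventually (\<lambda>n. \<forall>k\<in>F. level_bits V (Xn n \<omega>) k = level_bits V (X \<omega>) k) sequentially"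
        using F ev[OF \<omega>] by (intro eventually_ball_finite) auto
      then show "eventually (\<lambda>n. indicator (?E n) \<omega> = (indicator ?E' \<omega> :: real)) sequentially"
        by eventually_elim (auto simp: indicator_def)
    qed
  qed (auto simp: indicator_def)
  then show ?thesis by simp
qed

text \<open>
  Couplings of \<open>Xn n\<close> and \<open>Yn n\<close> for different \<open>n\<close> need not be related to each other. A coupling
  of the limits is obtained by compactness from the joint laws of the level bits. Its
  marginals are identified through the finite-dimensional laws of the bits, and the order
  survives because \<open>Y \<le> X\<close> is the conjunction of countably many conditions, each on two bits.
\<close>

lemma stochastically_dominated_decreasing_limit:
  fixes V :: "'v set" and X :: "'q \<Rightarrow> 'v \<Rightarrow> ereal" and Y :: "'p \<Rightarrow> 'v \<Rightarrow> ereal"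
  defines "N \<equiv> Pi\<^sub>M V (\<lambda>_. borel)"
  assumes V: "countable V" and P: "prob_space P" and Q: "prob_space Q"
    and X: "X \<in> measurable Q N" and Y: "Y \<in> measurable P N"
    and dom: "\<And>n. stochastically_dominated N P (Yn n) Q (Xn n)"
    and X_dec: "\<And>\<omega> x. \<omega> \<in> space Q \<Longrightarrow> x \<in> V \<Longrightarrow> decseq (\<lambda>n. Xn n \<omega> x)"
    and X_lim: "\<And>\<omega> x. \<omega> \<in> space Q \<Longrightarrow> x \<in> V \<Longrightarrow> (\<lambda>n. Xn n \<omega> x) \<longlonglongrightarrow> X \<omega> x"
    and Y_dec: "\<And>\<omega> x. \<omega> \<in> space P \<Longrightarrow> x \<in> V \<Longrightarrow> decseq (\<lambda>n. Yn n \<omega> x)"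
    and Y_lim: "\<And>\<omega> x. \<omega> \<in> space P \<Longrightarrow> x \<in> V \<Longrightarrow> (\<lambda>n. Yn n \<omega> x) \<longlonglongrightarrow> Y \<omega> x"
  shows "stochastically_dominated N P Y Q X"
proof -
  have Xn: "Xn n \<in> measurable Q N" and Yn: "Yn n \<in> measurable P N" for n
    using dom[of n] by (auto simp: stochastically_dominated_def)
  have "\<forall>n. \<exists>(R :: (('v \<Rightarrow> ereal) \<times> ('v \<Rightarrow> ereal)) measure) X' Y'. prob_space R \<and> X' \<in> measurable R N \<and> Y' \<in> measurable R N \<and>
      distr R N X' = distr Q N (Xn n) \<and> distr R N Y' = distr P N (Yn n) \<and>
      (AE \<omega> in R. X' \<omega> \<ge> Y' \<omega>)"
    using dom unfolding stochastically_dominated_def by blast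
  then obtain R :: "nat \<Rightarrow> (('v \<Rightarrow> ereal) \<times> ('v \<Rightarrow> ereal)) measure" and X' Y'
    where R: "\<And>n. prob_space (R n)"
      and X': "\<And>n. X' n \<in> measurable (R n) N" and Y': "\<And>n. Y' n \<in> measurable (R n) N"
      and X'_law: "\<And>n. distr (R n) N (X' n) = distr Q N (Xn n)"
      and Y'_law: "\<And>n. distr (R n) N (Y' n) = distr P N (Yn n)"
      and le: "\<And>n. AE \<omega> in R n. X' n \<omega> \<ge> Y' n \<omega>"
    unfolding choice_iff by blast
  define B where "B n \<omega> = (\<lambda>(is_Y, k). level_bits V (if is_Y then Y' n \<omega> else X' n \<omega>) k)" for n \<omega>
  have B_pred: "Measurable.pred (R n) (\<lambda>\<omega>. B n \<omega> k)" for n k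
    using pred_level_bits[OF X'[unfolded N_def]] pred_level_bits[OF Y'[unfolded N_def]]
    by (cases k; cases "fst k") (auto simp: B_def)
  obtain s M b where s: "strict_mono (s :: nat \<Rightarrow> nat)" and M: "prob_space (M :: real measure)"
    and b: "\<And>k. Measurable.pred M (\<lambda>z. b z k)"
    and conv: "\<And>F A. finite F \<Longrightarrow>
       (\<lambda>n. measure (R (s n)) {\<omega>\<in>space (R (s n)). \<forall>k\<in>F. B (s n) \<omega> k \<in> A k})
         \<longlonglongrightarrow> measure M {z\<in>space M. \<forall>k\<in>F. b z k \<in> A k}"
    using random_bits_convergent_subsequence[of R B, OF R B_pred] by blast
  interpret M: prob_space M by (rule M)
  note [measurable] = b
  (* Both marginals are treated at once: \<open>Z\<close> stands for \<open>X\<close> or \<open>Y\<close>, with its bits selected by \<open>is_Y\<close>. *)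
  have marginal: "distr M N (\<lambda>z. decode_levels V (\<lambda>k. b z (is_Y, k))) = distr S N Z"
    if S: "prob_space S" and Z: "Z \<in> measurable S N" and Zn: "\<And>n. Zn n \<in> measurable S N"
      and dec: "\<And>\<omega> x. \<omega> \<in> space S \<Longrightarrow> x \<in> V \<Longrightarrow> decseq (\<lambda>n. Zn n \<omega> x)"
      and lim: "\<And>\<omega> x. \<omega> \<in> space S \<Longrightarrow> x \<in> V \<Longrightarrow> (\<lambda>n. Zn n \<omega> x) \<longlonglongrightarrow> Z \<omega> x"
      and Z': "\<And>n. Z' n \<in> measurable (R n) N"
      and law: "\<And>n. distr (R n) N (Z' n) = distr S N (Zn n)"
      and BZ: "\<And>n \<omega> k. B n \<omega> (is_Y, k) = level_bits V (Z' n \<omega>) k"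
    for S :: "'s measure" and Z Zn Z' is_Y
    unfolding N_def
  proof (rule distr_decode_levels_eq[OF V M S Z[unfolded N_def]])
    fix F :: "(nat \<times> rat) set" and A :: "nat \<times> rat \<Rightarrow> bool set" assume F: "finite F"
    have "{f\<in>space N. \<forall>k\<in>F. level_bits V f k \<in> A k} \<in> sets N"
    proof -
      note [measurable] = pred_level_bits[of "\<lambda>f. f" N V, folded N_def, OF measurable_ident_sets[OF refl]]
      have [measurable]: "countable F" using F by (rule countable_finite)
      show ?thesis by measurable
    qed
    note E = this
    have "measure (R n) {\<omega>\<in>space (R n). \<forall>k\<in>F. level_bits V (Z' n \<omega>) k \<in> A k}
        = measure S {\<omega>\<in>space S. \<forall>k\<in>F. level_bits V (Zn n \<omega>) k \<in> A k}" for n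
    proof -
      have "measure (R n) {\<omega>\<in>space (R n). \<forall>k\<in>F. level_bits V (Z' n \<omega>) k \<in> A k}
          = measure (distr (R n) N (Z' n)) {f\<in>space N. \<forall>k\<in>F. level_bits V f k \<in> A k}"
        using measurable_space[OF Z'[of n]]
        by (subst measure_distr[OF Z' E]) (auto intro!: arg_cong[where f="measure (R n)"])
      also have "\<dots> = measure S {\<omega>\<in>space S. \<forall>k\<in>F. level_bits V (Zn n \<omega>) k \<in> A k}"
        unfolding law using measurable_space[OF Zn[of n]]
        by (subst measure_distr[OF Zn E]) (auto intro!: arg_cong[where f="measure S"])
      finally show ?thesis .
    qed
    then have "(\<lambda>n. measure (R n) {\<omega>\<in>space (R n). \<forall>k\<in>F. level_bits V (Z' n \<omega>) k \<in> A k})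
        \<longlonglongrightarrow> measure S {\<omega>\<in>space S. \<forall>k\<in>F. level_bits V (Z \<omega>) k \<in> A k}"
      using level_bits_prob_tendsto[OF S Z[unfolded N_def] Zn[unfolded N_def] dec lim F, of A] by simp
    from LIMSEQ_subseq_LIMSEQ[OF this s]
    have "(\<lambda>n. measure (R (s n)) {\<omega>\<in>space (R (s n)). \<forall>k\<in>F. level_bits V (Z' (s n) \<omega>) k \<in> A k})
        \<longlonglongrightarrow> measure S {\<omega>\<in>space S. \<forall>k\<in>F. level_bits V (Z \<omega>) k \<in> A k}"
      by (simp add: comp_def)
    moreover have "(\<lambda>n. measure (R (s n)) {\<omega>\<in>space (R (s n)). \<forall>k\<in>F. level_bits V (Z' (s n) \<omega>) k \<in> A k})
        \<longlonglongrightarrow> measure M {z\<in>space M. \<forall>k\<in>F. b z (is_Y, k) \<in> A k}"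
      using conv[of "Pair is_Y ` F" "\<lambda>k. A (snd k)"] F by (simp add: BZ)
    ultimately show "measure M {z\<in>space M. \<forall>k\<in>F. b z (is_Y, k) \<in> A k}
        = measure S {\<omega>\<in>space S. \<forall>k\<in>F. level_bits V (Z \<omega>) k \<in> A k}"
      by (rule LIMSEQ_unique[rotated])
  qed (rule b)
  have "AE z in M. b z (False, k) \<longrightarrow> b z (True, k)" for k
  proof -
    let ?A = "\<lambda>(is_Y, _). {\<not> is_Y}" and ?F = "{(False, k), (True, k)}"
    have "measure (R n) {\<omega>\<in>space (R n). \<forall>k\<in>?F. B n \<omega> k \<in> ?A k} = 0" for n
    proof -
      interpret R: prob_space "R n" by (rule R)
      have "AE \<omega> in R n. \<not> (\<forall>k\<in>?F. B n \<omega> k \<in> ?A k)"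
        using le[of n]
        by eventually_elim (auto simp: B_def level_bits_def case_prod_beta le_fun_def dest: le_less_trans)
      then show ?thesis by (subst R.prob_eq_0) (use B_pred in \<open>auto simp: pred_def\<close>)
    qed
    then have "measure M {z\<in>space M. \<forall>k\<in>?F. b z k \<in> ?A k} = 0"
      using conv[of ?F ?A] by (simp add: LIMSEQ_const_iff)
    then show ?thesis
      by (subst (asm) M.prob_eq_0) auto
  qed
  then have b_le: "AE z in M. \<forall>k. b z (False, k) \<longrightarrow> b z (True, k)"
    by (simp add: AE_all_countable)
  have dec_meas: "(\<lambda>z. decode_levels V (\<lambda>k. b z (is_Y, k))) \<in> measurable M N" for is_Y
    unfolding N_def
    by (rule measurable_compose[OF _ measurable_decode_levels], rule measurable_PiM_single') auto
  show ?thesis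
    unfolding N_def
  proof (rule stochastically_dominatedI[OF V M X[unfolded N_def] Y[unfolded N_def]
        dec_meas[unfolded N_def] dec_meas[unfolded N_def]])
    show "distr M (Pi\<^sub>M V (\<lambda>_. borel)) (\<lambda>z. decode_levels V (\<lambda>k. b z (False, k)))
        = distr Q (Pi\<^sub>M V (\<lambda>_. borel)) X"
      using marginal[of Q X Xn X' False] Q X Xn X_dec X_lim X' X'_law by (simp add: B_def N_def)
    show "distr M (Pi\<^sub>M V (\<lambda>_. borel)) (\<lambda>z. decode_levels V (\<lambda>k. b z (True, k)))
        = distr P (Pi\<^sub>M V (\<lambda>_. borel)) Y"
      using marginal[of P Y Yn Y' True] P Y Yn Y_dec Y_lim Y' Y'_law by (simp add: B_def N_def)
    show "AE z in M. \<forall>x\<in>V. decode_levels V (\<lambda>k. b z (True, k)) x \<le> decode_levels V (\<lambda>k. b z (False, k)) x"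
      using b_le by eventually_elim (auto intro: decode_levels_mono)
  qed
qed

lemma measurable_pointwise_limit:
  fixes Z :: "'s \<Rightarrow> 'v \<Rightarrow> ereal"
  assumes Zn: "\<And>n. Zn n \<in> measurable S (Pi\<^sub>M V (\<lambda>_. borel))"
    and lim: "\<And>\<omega> x. x \<in> V \<Longrightarrow> (\<lambda>n. Zn n \<omega> x) \<longlonglongrightarrow> Z \<omega> x"
  shows "(\<lambda>\<omega>. \<lambda>x\<in>V. Z \<omega> x) \<in> measurable S (Pi\<^sub>M V (\<lambda>_. borel))"
proof (rule measurable_restrict)
  fix x assume x: "x \<in> V"
  show "(\<lambda>\<omega>. Z \<omega> x) \<in> borel_measurable S"
  proof (rule borel_measurable_LIMSEQ_order)
    show "(\<lambda>n. Zn n \<omega> x) \<longlonglongrightarrow> Z \<omega> x" for \<omega> by (rule lim[OF x])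
    show "(\<lambda>\<omega>. Zn n \<omega> x) \<in> borel_measurable S" for n
      by (rule measurable_compose[OF Zn measurable_component_singleton[OF x]])
  qed
qed

section \<open>Discrete approximations of passage times\<close>

lemma ennreal_inverse_inverse: "inverse (inverse x) = (x :: ennreal)"
proof (cases x)
  case (real r)
  then show ?thesis by (cases "r = 0") (auto simp: inverse_ennreal)
qed simp

lemma ennreal_inverse_antimono: "x \<le> y \<Longrightarrow> inverse y \<le> inverse (x :: ennreal)"
  unfolding less_eq_ennreal.rep_eq inverse_ennreal.rep_eq
  by (rule ereal_inverse_antimono) auto

text \<open>
  Passage times have to be rounded upwards, so that occupation times decrease to their limits.
  The inversion of \<open>[0, \<infinity>]\<close> turns the standard approximation of measurable functions by
  simple functions from below into one from above.
\<close>

lemma ennreal_simple_approximation_from_above: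
  obtains r :: "nat \<Rightarrow> ennreal \<Rightarrow> ennreal"
  where "\<And>n. simple_function borel (r n)" "\<And>w. decseq (\<lambda>n. r n w)" "\<And>w. (\<lambda>n. r n w) \<longlonglongrightarrow> w"
proof -
  have "(inverse :: ennreal \<Rightarrow> ennreal) \<in> borel_measurable borel" by measurable
  then obtain f :: "nat \<Rightarrow> ennreal \<Rightarrow> ennreal" where f: "\<And>n. simple_function borel (f n)"
    "incseq f" "\<And>w. (SUP n. f n w) = inverse w"
    using borel_measurable_implies_simple_function_sequence' by metis
  have inc: "incseq (\<lambda>n. f n w)" for w using f(2) by (auto simp: incseq_def le_fun_def)
  show thesis
  proof (rule that[of "\<lambda>n w. inverse (f n w)"])
    show "simple_function borel (\<lambda>w. inverse (f n w))" for n
      using simple_function_compose[OF f(1)[of n], of inverse] by (simp add: comp_def)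
    show "decseq (\<lambda>n. inverse (f n w))" for w
      using inc[of w] by (auto simp: decseq_def incseq_def intro: ennreal_inverse_antimono)
    have "(\<lambda>n. f n w) \<longlonglongrightarrow> inverse w" for w
      using LIMSEQ_SUP[OF inc] f(3) by simp
    moreover have "isCont (inverse :: ennreal \<Rightarrow> ennreal) z" for z
      using continuous_on_inverse_ennreal[OF continuous_on_id, of UNIV]
      by (simp add: continuous_on_eq_continuous_at)
    ultimately have "(\<lambda>n. inverse (f n w)) \<longlonglongrightarrow> inverse (inverse w)" for w
      by (rule isCont_tendsto_compose[rotated])
    then show "(\<lambda>n. inverse (f n w)) \<longlonglongrightarrow> w" for w by (simp add: ennreal_inverse_inverse)
  qed
qed

lemma finite_range_law_pmf:
  assumes M: "prob_space M" and fin: "finite (Z ` space M)"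
    and Z: "\<And>c. {\<omega>\<in>space M. Z \<omega> = c} \<in> sets M"
  shows "Z \<in> measurable M (count_space UNIV)"
    and "\<exists>p. measure_pmf p = distr M (count_space UNIV) Z"
proof -
  interpret prob_space M by fact
  have "simple_function M Z"
    unfolding simple_function_def using fin Z by (auto simp: vimage_def Int_def conj_commute)
  then show Z_meas[measurable]: "Z \<in> measurable M (count_space UNIV)"
    by (rule measurable_simple_function)
  let ?D = "distr M (count_space UNIV) Z"
  interpret D: prob_space ?D by (rule prob_space_distr) (rule Z_meas)
  have "AE c in ?D. c \<in> Z ` space M"
    by (subst AE_distr_iff) auto
  then have "AE c in ?D. measure ?D {c} \<noteq> 0"
    using D.AE_support_countable fin by (auto intro: countable_finite)
  then have "measure_pmf (Abs_pmf ?D) = ?D"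
    by (intro Abs_pmf_inverse) (auto simp: D.prob_space_axioms)
  then show "\<exists>p. measure_pmf p = ?D" by blast
qed

lemma distr_eq_measure_pmf:
  assumes M: "prob_space M" and fin: "finite (Z ` space M)"
    and Z: "\<And>c. {\<omega>\<in>space M. Z \<omega> = c} \<in> sets M"
    and eq: "\<And>c. measure M {\<omega>\<in>space M. Z \<omega> = c} = pmf p c"
  shows "Z \<in> measurable M (count_space UNIV)" "distr M (count_space UNIV) Z = measure_pmf p"
proof -
  show Z_meas: "Z \<in> measurable M (count_space UNIV)" by (rule finite_range_law_pmf[OF M fin Z])
  obtain p' where p': "measure_pmf p' = distr M (count_space UNIV) Z"
    using finite_range_law_pmf(2)[OF M fin Z] by blast
  have "pmf p' c = pmf p c" for c
  proof -
    have "pmf p' c = measure (distr M (count_space UNIV) Z) {c}"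
      by (simp only: pmf.rep_eq p')
    also have "\<dots> = measure M {\<omega>\<in>space M. Z \<omega> = c}"
      by (subst measure_distr[OF Z_meas]) (auto intro!: arg_cong[where f = "measure M"])
    finally show ?thesis by (simp only: eq)
  qed
  then have "p' = p" by (rule pmf_eqI)
  with p' show "distr M (count_space UNIV) Z = measure_pmf p" by simp
qed

text \<open>
  Off the edges of \<open>F\<close> the rows are filled with \<open>0\<close>, the default value of the product laws
  below.
\<close>

definition outgoing_rows :: "'v set \<Rightarrow> ('v \<times> 'v \<Rightarrow> ennreal) \<Rightarrow> 'v \<Rightarrow> 'v \<Rightarrow> ennreal" where
  "outgoing_rows F w a b = (if (a, b) \<in> edges F then w (a, b) else 0)"

definition rows_pmf :: "'v set \<Rightarrow> ('v \<times> 'v \<Rightarrow> ennreal pmf) \<Rightarrow> 'v \<Rightarrow> ('v \<Rightarrow> ennreal) pmf" where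
  "rows_pmf F q a = Pi_pmf (F - {a}) 0 (\<lambda>b. q (a, b))"

lemma finite_edges: "finite F \<Longrightarrow> finite (edges F)"
  by (rule finite_subset[of _ "F \<times> F"]) (auto simp: edges_def)

lemma outgoing_rows_eq_iff:
  "outgoing_rows F w = c \<longleftrightarrow>
    (\<forall>a b. (a, b) \<notin> edges F \<longrightarrow> c a b = 0) \<and> (\<forall>e\<in>edges F. w e = c (fst e) (snd e))"
  by (auto simp: outgoing_rows_def fun_eq_iff)

lemma occupation_time_outgoing_rows:
  "occupation_time F t (\<lambda>(a, b). outgoing_rows F w a b) x = occupation_time F t w x"
  by (rule occupation_time_cong) (auto simp: outgoing_rows_def)

lemma pmf_Pi_rows_pmf:
  assumes F: "finite F"
  shows "pmf (Pi_pmf F (\<lambda>_. 0) (rows_pmf F q)) c =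
    (if \<forall>a b. (a, b) \<notin> edges F \<longrightarrow> c a b = 0 then \<Prod>e\<in>edges F. pmf (q e) (c (fst e) (snd e)) else 0)"
proof (cases "\<forall>a b. (a, b) \<notin> edges F \<longrightarrow> c a b = 0")
  case True
  have edges: "edges F = Sigma F (\<lambda>a. F - {a})" by (auto simp: edges_def)
  have "pmf (Pi_pmf F (\<lambda>_. 0) (rows_pmf F q)) c = (\<Prod>a\<in>F. pmf (rows_pmf F q a) (c a))"
    using F True by (subst pmf_Pi) (auto simp: edges_def fun_eq_iff)
  also have "\<dots> = (\<Prod>a\<in>F. \<Prod>b\<in>F - {a}. pmf (q (a, b)) (c a b))"
    using F True by (intro prod.cong refl) (auto simp: rows_pmf_def pmf_Pi edges_def)
  also have "\<dots> = (\<Prod>e\<in>edges F. pmf (q e) (c (fst e) (snd e)))"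
    unfolding edges using F by (subst prod.Sigma) (auto simp: case_prod_beta)
  finally show ?thesis using True by simp
next
  case False
  then obtain a b where ab: "(a, b) \<notin> edges F" "c a b \<noteq> 0" by auto
  have "pmf (Pi_pmf F (\<lambda>_. 0) (rows_pmf F q)) c = 0"
  proof (cases "a \<in> F")
    case True
    then have "b \<notin> F - {a}" using ab(1) by (auto simp: edges_def)
    with ab(2) F have "pmf (rows_pmf F q a) (c a) = 0" by (auto simp: rows_pmf_def pmf_Pi)
    then show ?thesis using F True by (auto simp: pmf_Pi)
  next
    case False
    then show ?thesis using F ab(2) by (auto simp: pmf_Pi fun_eq_iff)
  qed
  then show ?thesis by (simp only: if_not_P[OF False])
qed

lemma finite_range_outgoing_rows:
  assumes "finite F" "finite (range r)"
  shows "finite (range (\<lambda>w. outgoing_rows F (\<lambda>e. r (w e))))"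
proof (rule finite_subset)
  show "range (\<lambda>w. outgoing_rows F (\<lambda>e. r (w e)))
      \<subseteq> outgoing_rows F ` (PiE (edges F) (\<lambda>_. range r))"
  proof clarify
    fix w
    have "outgoing_rows F (\<lambda>e. r (w e)) = outgoing_rows F (restrict (\<lambda>e. r (w e)) (edges F))"
      by (auto simp: outgoing_rows_def fun_eq_iff)
    then show "outgoing_rows F (\<lambda>e. r (w e)) \<in> outgoing_rows F ` (PiE (edges F) (\<lambda>_. range r))"
      by (auto intro!: imageI)
  qed
  show "finite (outgoing_rows F ` (PiE (edges F) (\<lambda>_. range r)))"
    by (intro finite_imageI finite_PiE finite_edges assms)
qed

lemma (in fpp_model) prob_outgoing_rows:
  assumes F: "finite F" "F \<subseteq> V" and r[measurable]: "r \<in> measurable borel (count_space UNIV)"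
    and q: "\<And>e x. e \<in> edges V \<Longrightarrow> pmf (q e) x = measure (\<mu> e) {w. r w = x}"
  shows "{\<omega>\<in>space M. outgoing_rows F (\<lambda>e. r (W e \<omega>)) = c} \<in> events" (is "?E \<in> _")
    and "prob {\<omega>\<in>space M. outgoing_rows F (\<lambda>e. r (W e \<omega>)) = c}
      = pmf (Pi_pmf F (\<lambda>_. 0) (rows_pmf F q)) c"
proof -
  note fin = finite_edges[OF F(1)] and sub = edges_mono[OF F(2)]
  have W: "random_variable borel (W e)" if "e \<in> edges V" for e
    using indep_W that by (auto simp: indep_vars_def)
  have set[measurable]: "{w. r w = x} \<in> sets borel" for x
    using measurable_sets[OF r, of "{x}"] by (simp add: vimage_def)
  have ev: "W e -` {w. r w = x} \<inter> space M \<in> events" if "e \<in> edges F" for e x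
    by (rule measurable_sets[OF W[OF subsetD[OF sub that]] set])
  have single: "prob (W e -` {w. r w = x} \<inter> space M) = pmf (q e) x" if "e \<in> edges F" for e x
  proof -
    have "pmf (q e) x = measure (distr M borel (W e)) {w. r w = x}"
      using subsetD[OF sub that] by (simp add: distr_W q)
    also have "\<dots> = prob (W e -` {w. r w = x} \<inter> space M)"
      by (rule measure_distr[OF W[OF subsetD[OF sub that]] set])
    finally show ?thesis ..
  qed
  let ?ok = "\<forall>a b. (a, b) \<notin> edges F \<longrightarrow> c a b = 0"
  let ?I = "\<lambda>e. W e -` {w. r w = c (fst e) (snd e)} \<inter> space M"
  have E: "?E = (if ?ok then {\<omega>\<in>space M. \<forall>e\<in>edges F. r (W e \<omega>) = c (fst e) (snd e)} else {})"
    unfolding outgoing_rows_eq_iff by auto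
  show "?E \<in> events"
  proof (cases "?ok \<and> edges F \<noteq> {}")
    case True
    have "{\<omega>\<in>space M. r (W e \<omega>) = c (fst e) (snd e)} \<in> events" if "e \<in> edges F" for e
      using ev[OF that, of "c (fst e) (snd e)"] by (simp add: vimage_def Int_def conj_commute)
    with True fin show ?thesis unfolding E by (simp add: sets.sets_Collect_finite_All')
  next
    case False
    then have "?E = (if ?ok then space M else {})" unfolding E by auto
    then show ?thesis by simp
  qed
  show "prob ?E = pmf (Pi_pmf F (\<lambda>_. 0) (rows_pmf F q)) c"
  proof (cases "?ok \<and> edges F \<noteq> {}")
    case True
    then have "?E = (\<Inter>e\<in>edges F. ?I e)" unfolding E by auto
    also have "prob \<dots> = (\<Prod>e\<in>edges F. prob (?I e))"
      using True fin sub by (intro indep_varsD[OF indep_W]) auto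
    also have "\<dots> = (\<Prod>e\<in>edges F. pmf (q e) (c (fst e) (snd e)))"
      by (intro prod.cong refl single)
    finally show ?thesis using True by (simp add: pmf_Pi_rows_pmf F)
  next
    case False
    then have "?E = (if ?ok then space M else {})" unfolding E by auto
    moreover have "pmf (Pi_pmf F (\<lambda>_. 0) (rows_pmf F q)) c = (if ?ok then 1 else 0)"
      using False by (auto simp: pmf_Pi_rows_pmf[OF F(1)])
    ultimately show ?thesis
      by (simp only: if_distrib[of prob] prob_space measure_empty)
  qed
qed

lemma pmf_Pi_product:
  assumes "finite I" "finite F"
  shows "pmf (Pi_pmf (I \<times> F) d (p \<circ> snd)) c =
    (if \<forall>x. x \<notin> I \<times> F \<longrightarrow> c x = d then \<Prod>i\<in>I. pmf (Pi_pmf F d p) (\<lambda>a. c (i, a)) else 0)"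
proof (cases "\<forall>x. x \<notin> I \<times> F \<longrightarrow> c x = d")
  case True
  have "pmf (Pi_pmf (I \<times> F) d (p \<circ> snd)) c = (\<Prod>x\<in>I \<times> F. pmf (p (snd x)) (c x))"
    using assms True by (subst pmf_Pi) auto
  also have "\<dots> = (\<Prod>i\<in>I. \<Prod>a\<in>F. pmf (p a) (c (i, a)))"
    using assms by (subst prod.Sigma) (auto simp: case_prod_beta)
  also have "\<dots> = (\<Prod>i\<in>I. pmf (Pi_pmf F d p) (\<lambda>a. c (i, a)))"
    using assms True by (intro prod.cong refl) (auto simp: pmf_Pi)
  finally show ?thesis using True by simp
next
  case False
  then show ?thesis using assms by (subst pmf_Pi) auto
qed

context
  fixes V :: "'v set" and \<mu> :: "'v \<times> 'v \<Rightarrow> ennreal measure" and F :: "'v set"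
    and r :: "ennreal \<Rightarrow> ennreal" and q :: "'v \<times> 'v \<Rightarrow> ennreal pmf"
  assumes F: "finite F" "F \<subseteq> V" and r: "simple_function borel r"
    and q: "\<And>e x. e \<in> edges V \<Longrightarrow> pmf (q e) x = measure (\<mu> e) {w. r w = x}"
begin

lemma measurable_r: "r \<in> measurable borel (count_space UNIV)"
  using r by (rule measurable_simple_function)

lemma finite_range_r: "finite (range r)"
  using r by (simp add: simple_function_def)

lemma single_model_law:
  assumes "fpp_model Q V \<mu> t W"
  shows "(\<lambda>\<omega>. outgoing_rows F (\<lambda>e. r (W e \<omega>))) \<in> measurable Q (count_space UNIV)"
    and "distr Q (count_space UNIV) (\<lambda>\<omega>. outgoing_rows F (\<lambda>e. r (W e \<omega>)))
      = measure_pmf (Pi_pmf F (\<lambda>_. 0) (rows_pmf F q))"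
proof -
  interpret fpp_model Q V \<mu> t W by fact
  have "finite ((\<lambda>\<omega>. outgoing_rows F (\<lambda>e. r (W e \<omega>))) ` space Q)"
    by (rule finite_subset[OF _ finite_range_outgoing_rows[OF F(1) finite_range_r]]) auto
  note * = prob_space_axioms this prob_outgoing_rows[OF F measurable_r q]
  show "(\<lambda>\<omega>. outgoing_rows F (\<lambda>e. r (W e \<omega>))) \<in> measurable Q (count_space UNIV)"
    "distr Q (count_space UNIV) (\<lambda>\<omega>. outgoing_rows F (\<lambda>e. r (W e \<omega>)))
      = measure_pmf (Pi_pmf F (\<lambda>_. 0) (rows_pmf F q))"
    by (rule distr_eq_measure_pmf[OF *]; assumption)+
qed

text \<open>
  The joint law of all rows of the models in \<open>I0\<close>. Its point masses factorise over the models
  by \<open>indep\<close>, and then over the edges by the independence within each model.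
\<close>

lemma independent_models_law:
  assumes P: "prob_space P" and I: "finite I0" "I0 \<noteq> {}" "I0 \<subseteq> I"
    and models: "\<And>i. i \<in> I \<Longrightarrow> fpp_model P V \<mu> (t i) (W i)"
    and indep: "prob_space.indep_vars P (\<lambda>_. Pi\<^sub>M (edges V) (\<lambda>_. borel))
      (\<lambda>i \<omega>. \<lambda>e\<in>edges V. W i e \<omega>) I"
  defines "Z \<equiv> \<lambda>\<omega> (i, a). if i \<in> I0 then outgoing_rows F (\<lambda>e. r (W i e \<omega>)) a else (\<lambda>_. 0)"
  shows "Z \<in> measurable P (count_space UNIV)"
    and "distr P (count_space UNIV) Z
      = measure_pmf (Pi_pmf (I0 \<times> F) (\<lambda>_. 0) (rows_pmf F q \<circ> snd))"
proof -
  interpret prob_space P by (rule P)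
  let ?X = "\<lambda>i \<omega>. \<lambda>e\<in>edges V. W i e \<omega>" and ?O = "\<lambda>w. outgoing_rows F (\<lambda>e. r (w e))"
  let ?N = "Pi\<^sub>M (edges V) (\<lambda>_. borel) :: ('v \<times> 'v \<Rightarrow> ennreal) measure"
  note sub = edges_mono[OF F(2)]
  have fin_Z: "finite (Z ` space P)"
  proof (rule finite_subset)
    let ?S = "PiE I0 (\<lambda>_. range ?O)"
    let ?g = "\<lambda>h (i, a). if i \<in> I0 then h i a else (\<lambda>_. 0)"
    show "Z ` space P \<subseteq> ?g ` ?S"
    proof clarify
      fix \<omega>
      have "Z \<omega> = ?g (\<lambda>i\<in>I0. ?O (\<lambda>e. W i e \<omega>))" by (auto simp: Z_def fun_eq_iff)
      moreover have "(\<lambda>i\<in>I0. ?O (\<lambda>e. W i e \<omega>)) \<in> ?S" by auto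
      ultimately show "Z \<omega> \<in> ?g ` ?S" by (rule image_eqI)
    qed
    show "finite (?g ` ?S)"
      by (intro finite_imageI finite_PiE I finite_range_outgoing_rows[OF F(1) finite_range_r])
  qed
  have O_X: "?O (?X i \<omega>) = outgoing_rows F (\<lambda>e. r (W i e \<omega>))" for i \<omega>
    using sub by (auto simp: outgoing_rows_def fun_eq_iff)
  have O_sets: "{w\<in>space ?N. ?O w = c} \<in> sets ?N" for c
  proof -
    have "{w\<in>space ?N. r (w e) = x} \<in> sets ?N" if "e \<in> edges F" for e x
    proof -
      have "(\<lambda>w. w e) \<in> measurable ?N borel"
        by (rule measurable_component_singleton) (use that sub in auto)
      from measurable_sets[OF measurable_compose[OF this measurable_r], of "{x}"] show ?thesis
        by (simp add: vimage_def Int_def conj_commute)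
    qed
    then have "{w\<in>space ?N. \<forall>e\<in>edges F. r (w e) = c (fst e) (snd e)} \<in> sets ?N"
      by (intro sets.sets_Collect_finite_All finite_edges F) auto
    moreover have "{w\<in>space ?N. ?O w = c} = (if \<forall>a b. (a, b) \<notin> edges F \<longrightarrow> c a b = 0
        then {w\<in>space ?N. \<forall>e\<in>edges F. r (w e) = c (fst e) (snd e)} else {})"
      unfolding outgoing_rows_eq_iff by auto
    ultimately show ?thesis by (simp only: sets.empty_sets split: if_split) blast
  qed
  let ?ok = "\<lambda>c. \<forall>x. x \<notin> I0 \<times> F \<longrightarrow> c x = (\<lambda>_. 0)"
  let ?I = "\<lambda>c i. ?X i -` {w\<in>space ?N. ?O w = (\<lambda>a. c (i, a))} \<inter> space P"
  have X: "random_variable ?N (?X i)" if "i \<in> I0" for i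
    using indep that I by (auto simp: indep_vars_def)
  have I_eq: "?I c i = {\<omega>\<in>space P. outgoing_rows F (\<lambda>e. r (W i e \<omega>)) = (\<lambda>a. c (i, a))}"
    if "i \<in> I0" for c i
    using measurable_space[OF X[OF that]] by (auto simp: O_X simp del: restrict_apply)
  have Z_eq: "{\<omega>\<in>space P. Z \<omega> = c} = (if ?ok c then (\<Inter>i\<in>I0. ?I c i) else {})" for c
  proof -
    have "Z \<omega> = c \<longleftrightarrow> ?ok c \<and> (\<forall>i\<in>I0. outgoing_rows F (\<lambda>e. r (W i e \<omega>)) = (\<lambda>a. c (i, a)))" for \<omega>
      by (auto simp: Z_def fun_eq_iff outgoing_rows_def edges_def)
    moreover have "(\<Inter>i\<in>I0. ?I c i)
        = {\<omega>\<in>space P. \<forall>i\<in>I0. outgoing_rows F (\<lambda>e. r (W i e \<omega>)) = (\<lambda>a. c (i, a))}"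
      using I by (subst INF_cong[OF refl I_eq]) auto
    ultimately show ?thesis by auto
  qed
  have Z_sets: "{\<omega>\<in>space P. Z \<omega> = c} \<in> sets P" for c
  proof -
    have "(\<Inter>i\<in>I0. ?I c i) \<in> sets P"
      by (intro sets.finite_INT I measurable_sets[OF X] O_sets)
    then show ?thesis by (simp only: Z_eq sets.empty_sets simp_thms split: if_split)
  qed
  have Z_prob: "prob {\<omega>\<in>space P. Z \<omega> = c}
      = pmf (Pi_pmf (I0 \<times> F) (\<lambda>_. 0) (rows_pmf F q \<circ> snd)) c" for c
  proof (cases "?ok c")
    case True
    have "prob {\<omega>\<in>space P. Z \<omega> = c} = prob (\<Inter>i\<in>I0. ?I c i)"
      by (subst Z_eq, subst if_P[OF True]) (rule refl)
    also have "\<dots> = (\<Prod>i\<in>I0. prob (?I c i))"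
      using I by (intro indep_varsD[OF indep] O_sets)
    also have "\<dots> = (\<Prod>i\<in>I0. pmf (Pi_pmf F (\<lambda>_. 0) (rows_pmf F q)) (\<lambda>a. c (i, a)))"
      using I by (intro prod.cong refl, subst I_eq)
        (auto intro!: fpp_model.prob_outgoing_rows(2)[OF models F measurable_r q])
    also have "\<dots> = pmf (Pi_pmf (I0 \<times> F) (\<lambda>_. 0) (rows_pmf F q \<circ> snd)) c"
      unfolding pmf_Pi_product[OF I(1) F(1)] if_P[OF True] by (rule refl)
    finally show ?thesis .
  next
    case False
    show ?thesis
      unfolding Z_eq pmf_Pi_product[OF I(1) F(1)] if_not_P[OF False] by (rule measure_empty)
  qed
  show "Z \<in> measurable P (count_space UNIV)"
    "distr P (count_space UNIV) Z = measure_pmf (Pi_pmf (I0 \<times> F) (\<lambda>_. 0) (rows_pmf F q \<circ> snd))"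
    using distr_eq_measure_pmf[OF P fin_Z Z_sets Z_prob] by auto
qed

end

text \<open>
  For finitely many vertices, finitely many models and passage times rounded to finitely many
  values, the environments are discrete with product laws, and the exploration coupling
  applies.
\<close>

lemma discretized_stochastically_dominated:
  fixes V :: "'v set" and \<mu> :: "'v \<times> 'v \<Rightarrow> ennreal measure" and t :: "'i \<Rightarrow> 'v \<Rightarrow> ereal"
  assumes V: "countable V" and F: "finite F" "F \<subseteq> V" and r: "simple_function borel r"
    and \<mu>: "\<And>e. e \<in> edges V \<Longrightarrow> prob_space (\<mu> e) \<and> sets (\<mu> e) = sets borel"
    and P: "prob_space P" and I: "finite I0" "I0 \<noteq> {}" "I0 \<subseteq> I"
    and models: "\<And>i. i \<in> I \<Longrightarrow> fpp_model P V \<mu> (t i) (W i)"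
    and indep: "prob_space.indep_vars P (\<lambda>_. Pi\<^sub>M (edges V) (\<lambda>_. borel))
      (\<lambda>i \<omega>. \<lambda>e\<in>edges V. W i e \<omega>) I"
    and Q: "fpp_model Q V \<mu> s W'"
  shows "stochastically_dominated (Pi\<^sub>M V (\<lambda>_. borel))
    P (\<lambda>\<omega>. \<lambda>x\<in>V. INF i\<in>I0. occupation_time F (t i) (\<lambda>e. r (W i e \<omega>)) x)
    Q (\<lambda>\<omega>. \<lambda>x\<in>V. occupation_time F (\<lambda>x. INF i\<in>I0. t i x) (\<lambda>e. r (W' e \<omega>)) x)"
    (is "stochastically_dominated ?N P ?Y Q ?X")
proof -
  have "\<exists>p. \<forall>x. pmf p x = measure (\<mu> e) {w. r w = x}" if e: "e \<in> edges V" for e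
  proof -
    have sets: "sets (\<mu> e) = sets borel" and space: "space (\<mu> e) = UNIV"
      using \<mu>[OF e] sets_eq_imp_space_eq[of "\<mu> e" borel] by auto
    have fin: "finite (r ` space (\<mu> e))" "\<And>x. {w\<in>space (\<mu> e). r w = x} \<in> sets (\<mu> e)"
      using r measurable_sets[OF measurable_simple_function[OF r], of "{x}" for x]
      by (auto simp: simple_function_def space sets vimage_def)
    obtain p where p: "measure_pmf p = distr (\<mu> e) (count_space UNIV) r"
      using finite_range_law_pmf(2)[OF _ fin] \<mu>[OF e] by blast
    have "pmf p x = measure (\<mu> e) {w. r w = x}" for x
    proof -
      have "pmf p x = measure (distr (\<mu> e) (count_space UNIV) r) {x}"
        by (simp only: pmf.rep_eq p)
      also have "\<dots> = measure (\<mu> e) {w. r w = x}"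
        using finite_range_law_pmf(1)[OF _ fin] \<mu>[OF e]
        by (subst measure_distr) (auto simp: space vimage_def)
      finally show ?thesis .
    qed
    then show ?thesis by blast
  qed
  then have "\<forall>e. \<exists>p. e \<in> edges V \<longrightarrow> (\<forall>x. pmf p x = measure (\<mu> e) {w. r w = x})" by blast
  from choice[OF this] obtain q
    where q: "\<And>e x. e \<in> edges V \<Longrightarrow> pmf (q e) x = measure (\<mu> e) {w. r w = x}" by blast
  let ?d = "\<lambda>_ :: 'v. 0 :: ennreal" and ?t = "\<lambda>x. INF i\<in>I0. t i x"
  define env_Q where "env_Q \<omega> = outgoing_rows F (\<lambda>e. r (W' e \<omega>))" for \<omega>
  define env_P where "env_P = (\<lambda>\<omega> (i, a). if i \<in> I0 then outgoing_rows F (\<lambda>e. r (W i e \<omega>)) a else ?d)"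
  have env_Q: "env_Q \<in> measurable Q (count_space UNIV)"
      "distr Q (count_space UNIV) env_Q = measure_pmf (Pi_pmf F ?d (rows_pmf F q))"
    using single_model_law[OF F r q Q] by (simp_all add: env_Q_def[abs_def])
  have env_P: "env_P \<in> measurable P (count_space UNIV)"
      "distr P (count_space UNIV) env_P = measure_pmf (Pi_pmf (I0 \<times> F) ?d (rows_pmf F q \<circ> snd))"
    using independent_models_law[OF F r q P I models indep] by (simp_all only: env_P_def)
  define X where "X g = (\<lambda>x\<in>V. occupation_time F ?t (\<lambda>(a, b). g a b) x)" for g
  define Y where "Y f = (\<lambda>x\<in>V. INF i\<in>I0. occupation_time F (t i) (\<lambda>(a, b). f (i, a) b) x)" for f
  have X_env: "X (env_Q \<omega>) = ?X \<omega>" for \<omega>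
    by (simp only: X_def env_Q_def occupation_time_outgoing_rows)
  have Y_env: "Y (env_P \<omega>) = ?Y \<omega>" for \<omega>
  proof -
    have "occupation_time F (t i) (\<lambda>(a, b). env_P \<omega> (i, a) b) x
        = occupation_time F (t i) (\<lambda>e. r (W i e \<omega>)) x" if "i \<in> I0" for i x
      using that occupation_time_outgoing_rows[of F "t i" "\<lambda>e. r (W i e \<omega>)" x]
      by (simp add: env_P_def)
    then show ?thesis by (auto simp: Y_def fun_eq_iff restrict_def intro!: INF_cong)
  qed
  have X_meas: "X \<in> measurable (count_space UNIV) ?N" and Y_meas: "Y \<in> measurable (count_space UNIV) ?N"
    by (auto simp: X_def Y_def space_PiM)
  obtain G where G: "map_pmf G (Pi_pmf (I0 \<times> F) ?d (rows_pmf F q \<circ> snd)) = Pi_pmf F ?d (rows_pmf F q)"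
    and G_le: "\<And>f y. y \<in> F \<Longrightarrow> (INF i\<in>I0. occupation_time F (t i) (\<lambda>(a, b). f (i, a) b) y)
       \<le> occupation_time F ?t (\<lambda>(a, b). G f a b) y"
    using finite_coupling[OF F(1) I(1,2), of ?d "rows_pmf F q" t] by blast
  let ?R = "measure_pmf (Pi_pmf (I0 \<times> F) ?d (rows_pmf F q \<circ> snd))"
  have XG: "(\<lambda>f. X (G f)) \<in> measurable ?R ?N" and YR: "Y \<in> measurable ?R ?N"
    using X_meas Y_meas by (auto simp: measurable_def)
  show ?thesis
  proof (rule stochastically_dominatedI[OF V prob_space_measure_pmf _ _ XG YR])
    show "?X \<in> measurable Q ?N"
      using measurable_compose[OF env_Q(1) X_meas] by (simp only: X_env)
    show "?Y \<in> measurable P ?N"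
      using measurable_compose[OF env_P(1) Y_meas] by (simp only: Y_env)
    have "distr ?R ?N (\<lambda>f. X (G f)) = distr (map_pmf G (Pi_pmf (I0 \<times> F) ?d (rows_pmf F q \<circ> snd))) ?N X"
      unfolding map_pmf_rep_eq using X_meas by (subst distr_distr) (auto simp: comp_def)
    also have "\<dots> = distr (distr Q (count_space UNIV) env_Q) ?N X"
      by (simp only: G env_Q(2))
    also have "\<dots> = distr Q ?N ?X"
      by (subst distr_distr[OF X_meas env_Q(1)]) (simp only: comp_def X_env)
    finally show "distr ?R ?N (\<lambda>f. X (G f)) = distr Q ?N ?X" .
    have "distr ?R ?N Y = distr (distr P (count_space UNIV) env_P) ?N Y"
      by (simp only: env_P(2))
    also have "\<dots> = distr P ?N ?Y"
      by (subst distr_distr[OF Y_meas env_P(1)]) (simp only: comp_def Y_env)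
    finally show "distr ?R ?N Y = distr P ?N ?Y" .
    have "Y f x \<le> X (G f) x" if x: "x \<in> V" for f x
    proof (cases "x \<in> F")
      case True
      then show ?thesis using G_le[of x f] x by (simp add: X_def Y_def)
    next
      (* Outside \<open>F\<close> there are no paths, and the infimum over the empty set is \<open>\<infinity>\<close>. *)
      case False
      then have "paths_to F x = {}" by (auto simp: paths_to_def dest: last_in_set)
      then show ?thesis using x by (simp add: X_def occupation_time_def top_ereal_def)
    qed
    then show "AE f in ?R. \<forall>x\<in>V. Y f x \<le> X (G f) x" by simp
  qed
qed

section \<open>Superposition of first-passage percolation models\<close>

lemma INF_initial_segment_tendsto:
  fixes a :: "nat \<Rightarrow> 'i \<Rightarrow> ereal"
  assumes dec: "\<And>i. i \<in> range e \<Longrightarrow> decseq (\<lambda>n. a n i)"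
    and lim: "\<And>i. i \<in> range e \<Longrightarrow> (\<lambda>n. a n i) \<longlonglongrightarrow> a' i"
  shows "decseq (\<lambda>n. INF i\<in>e ` {..n}. a n i)"
    and "(\<lambda>n. INF i\<in>e ` {..n}. a n i) \<longlonglongrightarrow> (INF i\<in>range e. a' i)"
proof -
  show d: "decseq (\<lambda>n. INF i\<in>e ` {..n}. a n i)"
    unfolding decseq_def
  proof (intro allI impI INF_mono)
    fix m n :: nat and i assume "m \<le> n" "i \<in> e ` {..m}"
    then show "\<exists>j\<in>e ` {..n}. a n j \<le> a m i"
      using decseqD[OF dec, of i m n] by (intro bexI[of _ i]) auto
  qed
  have "(INF n. INF i\<in>e ` {..n}. a n i) = (INF i\<in>range e. a' i)"
  proof (intro antisym INF_greatest)
    fix n i assume "i \<in> e ` {..n}"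
    then show "(INF i\<in>range e. a' i) \<le> a n i"
      using decseq_ge[OF dec lim, of i n] by (intro INF_lower2[of i]) auto
  next
    fix i assume i: "i \<in> range e"
    then obtain k where k: "i = e k" by auto
    have "eventually (\<lambda>n. (INF n. INF i\<in>e ` {..n}. a n i) \<le> a n i) sequentially"
      using eventually_ge_at_top[of k]
      by eventually_elim (auto simp: k intro!: INF_lower2)
    then show "(INF n. INF i\<in>e ` {..n}. a n i) \<le> a' i"
      by (intro tendsto_lowerbound[OF lim[OF i]]) auto
  qed
  with LIMSEQ_INF[OF d] show "(\<lambda>n. INF i\<in>e ` {..n}. a n i) \<longlonglongrightarrow> (INF i\<in>range e. a' i)" by simp
qed

theorem theorem4:
  fixes V :: "'v set"
    and \<mu> :: "'v \<times> 'v \<Rightarrow> ennreal measure"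
    and I :: "'i set"
    and P :: "'p measure"
    and t :: "'i \<Rightarrow> 'v \<Rightarrow> ereal"
    and W :: "'i \<Rightarrow> 'v \<times> 'v \<Rightarrow> 'p \<Rightarrow> ennreal"
    and Q :: "'q measure"
    and W' :: "'v \<times> 'v \<Rightarrow> 'q \<Rightarrow> ennreal"
  assumes "countable V"
    and "countable I"
    and "\<And>e. e \<in> edges V \<Longrightarrow> prob_space (\<mu> e) \<and> sets (\<mu> e) = sets borel"
    and "prob_space P"
    and "\<And>i. i \<in> I \<Longrightarrow> fpp_model P V \<mu> (t i) (W i)"
    and "prob_space.indep_vars P (\<lambda>_. Pi\<^sub>M (edges V) (\<lambda>_. borel))
           (\<lambda>i \<omega>. \<lambda>e\<in>edges V. W i e \<omega>) I"
    and "fpp_model Q V \<mu> (\<lambda>x. INF i\<in>I. t i x) W'"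
  shows "stochastically_dominated_on V
           P (\<lambda>\<omega> x. INF i\<in>I. occupation_time V (t i) (\<lambda>e. W i e \<omega>) x)
           Q (\<lambda>\<omega> x. occupation_time V (\<lambda>x. INF i\<in>I. t i x) (\<lambda>e. W' e \<omega>) x)"
proof (cases "I = {}")
  (* Without models every source time is \<open>\<infinity>\<close>, so both sides are the constant \<open>\<infinity>\<close>. *)
  case True
  interpret P: prob_space P by fact
  interpret Q: fpp_model Q V \<mu> "\<lambda>x. INF i\<in>I. t i x" W' by fact
  have "occupation_time V (\<lambda>x. INF i\<in>I. t i x) w x = \<infinity>" for w x
    unfolding True occupation_time_eq_INF_path_time
    by (intro antisym INF_greatest) (auto simp: top_ereal_def)
  then have "stochastically_dominated (Pi\<^sub>M V (\<lambda>_. borel))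
      P (\<lambda>\<omega>. \<lambda>x\<in>V. INF i\<in>I. occupation_time V (t i) (\<lambda>e. W i e \<omega>) x)
      Q (\<lambda>\<omega>. \<lambda>x\<in>V. occupation_time V (\<lambda>x. INF i\<in>I. t i x) (\<lambda>e. W' e \<omega>) x)"
    unfolding True
    by (intro stochastically_dominatedI[of V Q _ Q _ P "\<lambda>_. \<lambda>x\<in>V. \<infinity>" "\<lambda>_. \<lambda>x\<in>V. \<infinity>"])
      (simp_all add: assms Q.prob_space_axioms space_PiM top_ereal_def)
  then show ?thesis by (simp add: stochastically_dominated_on_def)
next
  case False
  interpret P: prob_space P by fact
  interpret Q: fpp_model Q V \<mu> "\<lambda>x. INF i\<in>I. t i x" W' by fact
  let ?e = "from_nat_into I"
  have range_e: "range ?e = I" using False \<open>countable I\<close> by (rule range_from_nat_into)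
  obtain r :: "nat \<Rightarrow> ennreal \<Rightarrow> ennreal" where r: "\<And>n. simple_function borel (r n)" "\<And>w. decseq (\<lambda>n. r n w)"
    "\<And>w. (\<lambda>n. r n w) \<longlonglongrightarrow> w"
    by (rule ennreal_simple_approximation_from_above) (rule that; assumption)
  define F where "F n = {x\<in>V. to_nat_on V x \<le> n}" for n
  have F_finite: "finite (F n)" for n
  proof -
    have "F n = to_nat_on V -` {..n} \<inter> V" by (auto simp: F_def)
    then show ?thesis
      using finite_vimage_IntI[OF finite_atMost inj_on_to_nat_on[OF \<open>countable V\<close>]] by (simp only:)
  qed
  have F_sub: "F n \<subseteq> V" for n by (auto simp: F_def)
  have F_inc: "incseq F" by (auto simp: F_def incseq_def)
  have F_Un: "V = (\<Union>n. F n)" by (auto simp: F_def)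
  define In where "In n = ?e ` {..n}" for n
  define Yn where "Yn n \<omega> = (\<lambda>x\<in>V. INF i\<in>In n. occupation_time (F n) (t i) (\<lambda>e. r n (W i e \<omega>)) x)"
    for n \<omega>
  define Xn where "Xn n \<omega> = (\<lambda>x\<in>V. occupation_time (F n) (\<lambda>x. INF i\<in>In n. t i x) (\<lambda>e. r n (W' e \<omega>)) x)"
    for n \<omega>
  have dom: "stochastically_dominated (Pi\<^sub>M V (\<lambda>_. borel)) P (Yn n) Q (Xn n)" for n
    unfolding Yn_def[abs_def] Xn_def[abs_def]
    by (rule discretized_stochastically_dominated[where I = I and t = t and W = W])
      (use assms F_finite F_sub r(1) range_e in \<open>auto simp: In_def\<close>)
  have X_lim: "decseq (\<lambda>n. Xn n \<omega> x)"
      "(\<lambda>n. Xn n \<omega> x) \<longlonglongrightarrow> occupation_time V (\<lambda>x. INF i\<in>I. t i x) (\<lambda>e. W' e \<omega>) x"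
    if "x \<in> V" for \<omega> x
  proof -
    have t: "decseq (\<lambda>n. INF i\<in>In n. t i z)" "(\<lambda>n. INF i\<in>In n. t i z) \<longlonglongrightarrow> (INF i\<in>I. t i z)" for z
      using INF_initial_segment_tendsto[of ?e "\<lambda>_ i. t i z" "\<lambda>i. t i z"]
      by (simp_all add: In_def range_e)
    have "decseq (\<lambda>n. occupation_time (F n) (\<lambda>x. INF i\<in>In n. t i x) (\<lambda>e. r n (W' e \<omega>)) x)"
      by (rule occupation_time_tendsto(1)[OF F_inc F_Un, where t' = "\<lambda>x. INF i\<in>I. t i x"
            and w' = "\<lambda>e. W' e \<omega>"]) (intro t r Q.source_time; assumption)+
    moreover have "(\<lambda>n. occupation_time (F n) (\<lambda>x. INF i\<in>In n. t i x) (\<lambda>e. r n (W' e \<omega>)) x)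
        \<longlonglongrightarrow> occupation_time V (\<lambda>x. INF i\<in>I. t i x) (\<lambda>e. W' e \<omega>) x"
      by (rule occupation_time_tendsto(2)[OF F_inc F_Un]) (intro t r Q.source_time; assumption)+
    ultimately show "decseq (\<lambda>n. Xn n \<omega> x)"
      "(\<lambda>n. Xn n \<omega> x) \<longlonglongrightarrow> occupation_time V (\<lambda>x. INF i\<in>I. t i x) (\<lambda>e. W' e \<omega>) x"
      using that by (simp_all add: Xn_def)
  qed
  have Y_lim: "decseq (\<lambda>n. Yn n \<omega> x)"
      "(\<lambda>n. Yn n \<omega> x) \<longlonglongrightarrow> (INF i\<in>I. occupation_time V (t i) (\<lambda>e. W i e \<omega>) x)"
    if "x \<in> V" for \<omega> x
  proof -
    have "decseq (\<lambda>n. occupation_time (F n) (t i) (\<lambda>e. r n (W i e \<omega>)) x)"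
      "(\<lambda>n. occupation_time (F n) (t i) (\<lambda>e. r n (W i e \<omega>)) x)
        \<longlonglongrightarrow> occupation_time V (t i) (\<lambda>e. W i e \<omega>) x" if "i \<in> I" for i
    proof -
      interpret fpp_model P V \<mu> "t i" "W i" using assms(5) that .
      show "decseq (\<lambda>n. occupation_time (F n) (t i) (\<lambda>e. r n (W i e \<omega>)) x)"
        by (rule occupation_time_tendsto(1)[OF F_inc F_Un, where t' = "t i" and w' = "\<lambda>e. W i e \<omega>"])
          (auto simp: source_time intro: r)
      show "(\<lambda>n. occupation_time (F n) (t i) (\<lambda>e. r n (W i e \<omega>)) x)
          \<longlonglongrightarrow> occupation_time V (t i) (\<lambda>e. W i e \<omega>) x"
        by (rule occupation_time_tendsto(2)[OF F_inc F_Un]) (auto simp: source_time intro: r)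
    qed
    then show "decseq (\<lambda>n. Yn n \<omega> x)"
      "(\<lambda>n. Yn n \<omega> x) \<longlonglongrightarrow> (INF i\<in>I. occupation_time V (t i) (\<lambda>e. W i e \<omega>) x)"
      using INF_initial_segment_tendsto[of ?e "\<lambda>n i. occupation_time (F n) (t i) (\<lambda>e. r n (W i e \<omega>)) x"
          "\<lambda>i. occupation_time V (t i) (\<lambda>e. W i e \<omega>) x"] that
      by (simp_all add: Yn_def In_def range_e)
  qed
  have Xn_meas: "Xn n \<in> measurable Q (Pi\<^sub>M V (\<lambda>_. borel))"
    and Yn_meas: "Yn n \<in> measurable P (Pi\<^sub>M V (\<lambda>_. borel))" for n
    using dom[of n] by (simp_all add: stochastically_dominated_def)
  have "stochastically_dominated (Pi\<^sub>M V (\<lambda>_. borel))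
      P (\<lambda>\<omega>. \<lambda>x\<in>V. INF i\<in>I. occupation_time V (t i) (\<lambda>e. W i e \<omega>) x)
      Q (\<lambda>\<omega>. \<lambda>x\<in>V. occupation_time V (\<lambda>x. INF i\<in>I. t i x) (\<lambda>e. W' e \<omega>) x)"
  proof (rule stochastically_dominated_decreasing_limit[where Xn = Xn and Yn = Yn,
        OF \<open>countable V\<close> P.prob_space_axioms Q.prob_space_axioms _ _ dom])
    show "(\<lambda>\<omega>. \<lambda>x\<in>V. occupation_time V (\<lambda>x. INF i\<in>I. t i x) (\<lambda>e. W' e \<omega>) x)
        \<in> measurable Q (Pi\<^sub>M V (\<lambda>_. borel))"
      by (rule measurable_pointwise_limit[OF Xn_meas X_lim(2)])
    show "(\<lambda>\<omega>. \<lambda>x\<in>V. INF i\<in>I. occupation_time V (t i) (\<lambda>e. W i e \<omega>) x)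
        \<in> measurable P (Pi\<^sub>M V (\<lambda>_. borel))"
      by (rule measurable_pointwise_limit[OF Yn_meas Y_lim(2)])
  qed (simp_all add: X_lim Y_lim)
  then show ?thesis by (simp add: stochastically_dominated_on_def)
qed

end
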